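(* Let $M\times_\lambda N$ be the singly warped product of Riemannian manifolds $(M,g)$ and $(N,h)$, $n=\dim N$, with smooth non-constant warping function $\lambda:M\to(0,+\infty)$, and let $f:M\times_\lambda N\to(0,+\infty)$ be a smooth non-constant function. The projection map $\bar\pi_1:M\times_\lambda N\to M$, $\bar\pi_1(x,y)=x$, is a non-trivial $f$-bi-harmonic map if and only if $\lambda$ and $f$ satisfy $$\begin{aligned}&f\,\mathrm{Tr}_g({}^M\nabla)^2\,\mathrm{grad}_g\log\lambda+\frac n2f\,\mathrm{grad}_g\big(|\mathrm{grad}_g\log\lambda|^2\big)+f\,{}^M\mathrm{Ric}(\mathrm{grad}_g\log\lambda)\\&\quad+(\Delta_{M\times_\lambda N}f)\,\mathrm{grad}_g\log\lambda+2\,{}^M\nabla_{\mathrm{grad}_gf}\,\mathrm{grad}_g\log\lambda=0\end{aligned}$$ along $\bar\pi_1$, i.e. at every $(x,y)\in M\times N$.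
   Context: $M\times_\lambda N$ is $M\times N$ with the metric $\bar g=g\oplus\lambda^2h$; $\Delta_{M\times_\lambda N}$ is its Laplacian $\mathrm{div}\,\mathrm{grad}$; $\mathrm{grad}_gf$ is the partial gradient of $f(x,y)$ along $M$ w.r.t. $g$. Curvature convention $R(X,Y)Z=\nabla_X\nabla_YZ-\nabla_Y\nabla_XZ-\nabla_{[X,Y]}Z$. For a local orthonormal frame $\{e_j\}$ of $(M,g)$: ${}^M\mathrm{Ric}(X)=\sum_jR^M(X,e_j)e_j$, $\mathrm{Tr}_g({}^M\nabla)^2X=\sum_j({}^M\nabla_{e_j}{}^M\nabla_{e_j}X-{}^M\nabla_{{}^M\nabla_{e_j}e_j}X)$. For a smooth map $\phi:(P,k)\to(Q,q)$ and positive smooth $f$ on $P$, $\tau(\phi)=\mathrm{Tr}_k\nabla d\phi$; $\phi$ is $f$-bi-harmonic if it is a critical point of $\frac12\int_\Omega f|\tau(\phi)|^2dv_k$ for every compact domain $\Omega\subset P$; equivalently $\tau_{2,f}(\phi)=-\mathrm{Tr}_k(\nabla^\phi)^2(f\tau(\phi))-f\sum_iR^Q(\tau(\phi),d\phi(\epsilon_i))d\phi(\epsilon_i)=0$, where $\nabla^\phi$ is the pull-back connection, $\{\epsilon_i\}$ a local orthonormal frame of $P$, $\mathrm{Tr}_k(\nabla^\phi)^2V=\sum_i(\nabla^\phi_{\epsilon_i}\nabla^\phi_{\epsilon_i}V-\nabla^\phi_{\nabla_{\epsilon_i}\epsilon_i}V)$. An $f$-bi-harmonic map is called non-trivial if $f$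 is non-constant and the map is not harmonic. *)

theory Defs
  imports "HOL-Analysis.Analysis"
begin

section \<open>Smooth functions between Euclidean spaces\<close>

text \<open>Meant for open sets. In finite dimension, \<open>Ck_on k\<close> is the usual class \<open>C\<^sup>k\<close>: the derivative is
  tested on fixed vectors, so \<open>Ck_on (Suc k)\<close> says that all partial derivatives are \<open>C\<^sup>k\<close>.\<close>

primrec Ck_on :: "nat \<Rightarrow> 'a::euclidean_space set \<Rightarrow> ('a \<Rightarrow> 'b::real_normed_vector) \<Rightarrow> bool" where
  "Ck_on 0 S f \<longleftrightarrow> continuous_on S f"
| "Ck_on (Suc k) S f \<longleftrightarrow>
     (\<forall>x\<in>S. f differentiable at x) \<and> (\<forall>v. Ck_on k S (\<lambda>x. frechet_derivative f (at x) v))"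

definition smooth_on :: "'a::euclidean_space set \<Rightarrow> ('a \<Rightarrow> 'b::real_normed_vector) \<Rightarrow> bool" where
  "smooth_on S f \<longleftrightarrow> (\<forall>k. Ck_on k S f)"

abbreviation deriv_at :: "('a::euclidean_space \<Rightarrow> 'b::real_normed_vector) \<Rightarrow> 'a \<Rightarrow> 'a \<Rightarrow> 'b" where
  "deriv_at f z v \<equiv> frechet_derivative f (at z) v"


section \<open>Riemannian geometry in one coordinate domain\<close>

text \<open>A vector field on a coordinate domain is given by its components, a function \<open>'a \<Rightarrow> 'a\<close>; a
  metric is given by its component functions, \<open>G z u v\<close> being the inner product at the coordinate
  point \<open>z\<close> of the tangent vectors with components \<open>u\<close> and \<open>v\<close>. All operators below are local,
  so only the values of their arguments near \<open>z\<close> matter.\<close>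

type_synonym 'a metric_coeffs = "'a \<Rightarrow> 'a \<Rightarrow> 'a \<Rightarrow> real"

text \<open>\<open>christoffel G z u v\<close> has the components \<open>\<Gamma>\<^sup>k\<^sub>i\<^sub>j u\<^sup>i v\<^sup>j\<close>; this is the Koszul formula for
  the Levi-Civita connection on coordinate (constant-coefficient) fields, whose brackets vanish.\<close>

definition christoffel :: "'a::euclidean_space metric_coeffs \<Rightarrow> 'a \<Rightarrow> 'a \<Rightarrow> 'a \<Rightarrow> 'a" where
  "christoffel G z u v = (THE w. \<forall>\<xi>. 2 * G z w \<xi> =
     deriv_at (\<lambda>z'. G z' v \<xi>) z u + deriv_at (\<lambda>z'. G z' u \<xi>) z v - deriv_at (\<lambda>z'. G z' u v) z \<xi>)"

text \<open>The Levi-Civita derivative \<open>\<nabla>\<^sub>X Y\<close>.\<close>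

definition nabla ::
  "'a::euclidean_space metric_coeffs \<Rightarrow> ('a \<Rightarrow> 'a) \<Rightarrow> ('a \<Rightarrow> 'a) \<Rightarrow> 'a \<Rightarrow> 'a" where
  "nabla G X Y z = deriv_at Y z (X z) + christoffel G z (X z) (Y z)"

definition bracket :: "('a::euclidean_space \<Rightarrow> 'a) \<Rightarrow> ('a \<Rightarrow> 'a) \<Rightarrow> 'a \<Rightarrow> 'a" where
  "bracket X Y z = deriv_at Y z (X z) - deriv_at X z (Y z)"

definition curvature ::
  "'a::euclidean_space metric_coeffs \<Rightarrow> ('a \<Rightarrow> 'a) \<Rightarrow> ('a \<Rightarrow> 'a) \<Rightarrow> ('a \<Rightarrow> 'a) \<Rightarrow> 'a \<Rightarrow> 'a" where
  "curvature G X Y Z z =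
     nabla G X (nabla G Y Z) z - nabla G Y (nabla G X Z) z - nabla G (bracket X Y) Z z"

text \<open>The curvature tensor on vectors at the point \<open>z\<close>. Tensoriality makes the choice of extension
  immaterial; the coordinate fields are used. Values on vectors, not fields, are needed because the
  curvature of the target of a map is evaluated on sections along that map.\<close>

definition curv_at :: "'a::euclidean_space metric_coeffs \<Rightarrow> 'a \<Rightarrow> 'a \<Rightarrow> 'a \<Rightarrow> 'a \<Rightarrow> 'a" where
  "curv_at G z u v w = curvature G (\<lambda>_. u) (\<lambda>_. v) (\<lambda>_. w) z"

definition grad :: "'a::euclidean_space metric_coeffs \<Rightarrow> ('a \<Rightarrow> real) \<Rightarrow> 'a \<Rightarrow> 'a" where
  "grad G f z = (THE w. \<forall>\<xi>. G z w \<xi> = deriv_at f z \<xi>)"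

text \<open>The divergence of \<open>X\<close> is the trace of the endomorphism \<open>\<xi> \<mapsto> \<nabla>\<^sub>\<xi> X\<close>, which may be
  computed in any basis of the space of components.\<close>

definition divergence :: "'a::euclidean_space metric_coeffs \<Rightarrow> ('a \<Rightarrow> 'a) \<Rightarrow> 'a \<Rightarrow> real" where
  "divergence G X z = (\<Sum>b\<in>Basis. nabla G (\<lambda>_. b) X z \<bullet> b)"

definition laplacian :: "'a::euclidean_space metric_coeffs \<Rightarrow> ('a \<Rightarrow> real) \<Rightarrow> 'a \<Rightarrow> real" where
  "laplacian G f z = divergence G (grad G f) z"

text \<open>Smooth orthonormal frame fields \<open>(e b)\<close> on an open set \<open>U\<close>. The set \<open>Basis\<close> serves only as
  an index set of the right cardinality; nothing relates \<open>e b\<close> to \<open>b\<close>.\<close>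

definition orthonormal_frame ::
  "'a::euclidean_space metric_coeffs \<Rightarrow> 'a set \<Rightarrow> ('a \<Rightarrow> 'a \<Rightarrow> 'a) \<Rightarrow> bool" where
  "orthonormal_frame G U e \<longleftrightarrow> open U \<and> (\<forall>b\<in>Basis. smooth_on U (e b)) \<and>
     (\<forall>z\<in>U. \<forall>b\<in>Basis. \<forall>c\<in>Basis. G z (e b z) (e c z) = (if b = c then 1 else 0))"

definition ricci ::
  "'a::euclidean_space metric_coeffs \<Rightarrow> ('a \<Rightarrow> 'a \<Rightarrow> 'a) \<Rightarrow> ('a \<Rightarrow> 'a) \<Rightarrow> 'a \<Rightarrow> 'a" where
  "ricci G e X z = (\<Sum>b\<in>Basis. curv_at G z (X z) (e b z) (e b z))"

definition trace_nabla2 ::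
  "'a::euclidean_space metric_coeffs \<Rightarrow> ('a \<Rightarrow> 'a \<Rightarrow> 'a) \<Rightarrow> ('a \<Rightarrow> 'a) \<Rightarrow> 'a \<Rightarrow> 'a" where
  "trace_nabla2 G e X z =
     (\<Sum>b\<in>Basis. nabla G (e b) (nabla G (e b) X) z - nabla G (nabla G (e b) (e b)) X z)"


subsection \<open>Maps\<close>

text \<open>\<open>\<Phi>\<close> is the coordinate expression of a map from a domain with metric \<open>G\<close> to one with metric \<open>H\<close>.
  A section \<open>W\<close> along \<open>\<Phi>\<close> assigns to a source point a vector at its image.\<close>

definition dmap ::
  "('a::euclidean_space \<Rightarrow> 'b::euclidean_space) \<Rightarrow> ('a \<Rightarrow> 'a) \<Rightarrow> 'a \<Rightarrow> 'b" where
  "dmap \<Phi> X z = deriv_at \<Phi> z (X z)"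

text \<open>The pull-back connection \<open>\<nabla>\<^sup>\<Phi>\<^sub>X W\<close>.\<close>

definition pb_nabla :: "'b::euclidean_space metric_coeffs \<Rightarrow> ('a::euclidean_space \<Rightarrow> 'b) \<Rightarrow>
    ('a \<Rightarrow> 'a) \<Rightarrow> ('a \<Rightarrow> 'b) \<Rightarrow> 'a \<Rightarrow> 'b" where
  "pb_nabla H \<Phi> X W z = deriv_at W z (X z) + christoffel H (\<Phi> z) (dmap \<Phi> X z) (W z)"

text \<open>\<open>\<tau>(\<Phi>) = Tr \<nabla>d\<Phi>\<close>, where \<open>\<nabla>d\<Phi>(X, Y) = \<nabla>\<^sup>\<Phi>\<^sub>X d\<Phi>(Y) - d\<Phi>(\<nabla>\<^sub>X Y)\<close>.\<close>

definition tension :: "'a::euclidean_space metric_coeffs \<Rightarrow> 'b::euclidean_space metric_coeffs \<Rightarrow>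
    ('a \<Rightarrow> 'a \<Rightarrow> 'a) \<Rightarrow> ('a \<Rightarrow> 'b) \<Rightarrow> 'a \<Rightarrow> 'b" where
  "tension G H e \<Phi> z =
     (\<Sum>b\<in>Basis. pb_nabla H \<Phi> (e b) (dmap \<Phi> (e b)) z - dmap \<Phi> (nabla G (e b) (e b)) z)"

definition trace_pb_nabla2 ::
  "'a::euclidean_space metric_coeffs \<Rightarrow> 'b::euclidean_space metric_coeffs \<Rightarrow>
    ('a \<Rightarrow> 'a \<Rightarrow> 'a) \<Rightarrow> ('a \<Rightarrow> 'b) \<Rightarrow> ('a \<Rightarrow> 'b) \<Rightarrow> 'a \<Rightarrow> 'b" where
  "trace_pb_nabla2 G H e \<Phi> W z =
     (\<Sum>b\<in>Basis. pb_nabla H \<Phi> (e b) (pb_nabla H \<Phi> (e b) W) z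
        - pb_nabla H \<Phi> (nabla G (e b) (e b)) W z)"

definition f_bitension :: "'a::euclidean_space metric_coeffs \<Rightarrow> 'b::euclidean_space metric_coeffs \<Rightarrow>
    ('a \<Rightarrow> 'a \<Rightarrow> 'a) \<Rightarrow> ('a \<Rightarrow> real) \<Rightarrow> ('a \<Rightarrow> 'b) \<Rightarrow> 'a \<Rightarrow> 'b" where
  "f_bitension G H e f \<Phi> z =
     - trace_pb_nabla2 G H e \<Phi> (\<lambda>z'. f z' *\<^sub>R tension G H e \<Phi> z') z
     - f z *\<^sub>R (\<Sum>b\<in>Basis.
         curv_at H (\<Phi> z) (tension G H e \<Phi> z) (dmap \<Phi> (e b) z) (dmap \<Phi> (e b) z))"


section \<open>Riemannian manifolds\<close>

text \<open>The underlying space is the whole type \<open>'p\<close>; the atlas is a family of charts indexed by the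
  type \<open>'i\<close>, with values in the Euclidean space \<open>'a\<close>. The field \<open>gcoeffs\<close> gives the component
  functions of the metric in each chart.\<close>

record ('i, 'p, 'a) riem =
  cdom :: "'i \<Rightarrow> 'p set"
  coord :: "'i \<Rightarrow> 'p \<Rightarrow> 'a"
  gcoeffs :: "'i \<Rightarrow> 'a \<Rightarrow> 'a \<Rightarrow> 'a \<Rightarrow> real"

definition crange :: "('i, 'p, 'a) riem \<Rightarrow> 'i \<Rightarrow> 'a set" where
  "crange M i = coord M i ` cdom M i"

definition cinv :: "('i, 'p, 'a) riem \<Rightarrow> 'i \<Rightarrow> 'a \<Rightarrow> 'p" where
  "cinv M i = inv_into (cdom M i) (coord M i)"

definition transition :: "('i, 'p, 'a) riem \<Rightarrow> 'i \<Rightarrow> 'i \<Rightarrow> 'a \<Rightarrow> 'a" where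
  "transition M i j z = coord M j (cinv M i z)"

definition smooth_atlas ::
  "('i, 'p::topological_space, 'a::euclidean_space) riem \<Rightarrow> bool" where
  "smooth_atlas M \<longleftrightarrow>
     (\<Union>i. cdom M i) = UNIV \<and>
     (\<forall>i. open (cdom M i) \<and> open (crange M i) \<and>
        homeomorphism (cdom M i) (crange M i) (coord M i) (cinv M i)) \<and>
     (\<forall>i j. smooth_on (coord M i ` (cdom M i \<inter> cdom M j)) (transition M i j))"

definition riemannian_metric :: "('i, 'p, 'a::euclidean_space) riem \<Rightarrow> bool" where
  "riemannian_metric M \<longleftrightarrow>
     (\<forall>i. \<forall>z\<in>crange M i. bilinear (gcoeffs M i z) \<and>
        (\<forall>u v. gcoeffs M i z u v = gcoeffs M i z v u) \<and>
        (\<forall>u. u \<noteq> 0 \<longrightarrow> gcoeffs M i z u u > 0)) \<and>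
     (\<forall>i u v. smooth_on (crange M i) (\<lambda>z. gcoeffs M i z u v)) \<and>
     (\<forall>i j. \<forall>z\<in>coord M i ` (cdom M i \<inter> cdom M j). \<forall>u v.
        gcoeffs M j (transition M i j z)
          (deriv_at (transition M i j) z u) (deriv_at (transition M i j) z v)
        = gcoeffs M i z u v)"

text \<open>Connectedness is the usual convention; it makes a non-constant function have non-zero gradient
  somewhere.\<close>

definition riemannian_manifold ::
  "('i, 'p::{t2_space,second_countable_topology}, 'a::euclidean_space) riem \<Rightarrow> bool" where
  "riemannian_manifold M \<longleftrightarrow>
     connected (UNIV :: 'p set) \<and> smooth_atlas M \<and> riemannian_metric M"

definition smooth_fun :: "('i, 'p, 'a::euclidean_space) riem \<Rightarrow> ('p \<Rightarrow> real) \<Rightarrow> bool" where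
  "smooth_fun M f \<longleftrightarrow> (\<forall>i. smooth_on (crange M i) (f \<circ> cinv M i))"

text \<open>Coordinate expression of a map in the charts \<open>i\<close> and \<open>j\<close>.\<close>

definition map_coord ::
  "('i, 'p, 'a) riem \<Rightarrow> ('j, 'q, 'b) riem \<Rightarrow> ('p \<Rightarrow> 'q) \<Rightarrow> 'i \<Rightarrow> 'j \<Rightarrow> 'a \<Rightarrow> 'b" where
  "map_coord P Q \<phi> i j z = coord Q j (\<phi> (cinv P i z))"

definition smooth_map ::
  "('i, 'p::topological_space, 'a::euclidean_space) riem \<Rightarrow>
    ('j, 'q::topological_space, 'b::euclidean_space) riem \<Rightarrow> ('p \<Rightarrow> 'q) \<Rightarrow> bool" where
  "smooth_map P Q \<phi> \<longleftrightarrow> continuous_on UNIV \<phi> \<and>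
     (\<forall>i j. smooth_on (coord P i ` (cdom P i \<inter> \<phi> -` cdom Q j)) (map_coord P Q \<phi> i j))"

text \<open>The tension and bitension fields are sections of a vector bundle; they vanish at \<open>p\<close> iff their
  components do, in any charts around \<open>p\<close> and \<open>\<phi> p\<close> and for any local orthonormal frame of the
  source around \<open>p\<close>. The map is \<open>f\<close>-bi-harmonic when it satisfies the Euler--Lagrange equation
  \<open>\<tau>\<^sub>2\<^sub>,\<^sub>f(\<phi>) = 0\<close> of the functional \<open>1/2 \<integral> f |\<tau>(\<phi>)|\<^sup>2\<close>.\<close>

definition harmonic ::
  "('i, 'p::topological_space, 'a::euclidean_space) riem \<Rightarrow>
    ('j, 'q::topological_space, 'b::euclidean_space) riem \<Rightarrow> ('p \<Rightarrow> 'q) \<Rightarrow> bool" where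
  "harmonic P Q \<phi> \<longleftrightarrow> smooth_map P Q \<phi> \<and>
     (\<forall>i j p U e. p \<in> cdom P i \<and> \<phi> p \<in> cdom Q j \<and>
        coord P i p \<in> U \<and> U \<subseteq> crange P i \<and> orthonormal_frame (gcoeffs P i) U e \<longrightarrow>
        tension (gcoeffs P i) (gcoeffs Q j) e (map_coord P Q \<phi> i j) (coord P i p) = 0)"

definition f_biharmonic ::
  "('i, 'p::topological_space, 'a::euclidean_space) riem \<Rightarrow>
    ('j, 'q::topological_space, 'b::euclidean_space) riem \<Rightarrow> ('p \<Rightarrow> real) \<Rightarrow> ('p \<Rightarrow> 'q) \<Rightarrow> bool" where
  "f_biharmonic P Q f \<phi> \<longleftrightarrow> smooth_map P Q \<phi> \<and> smooth_fun P f \<and> (\<forall>p. f p > 0) \<and>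
     (\<forall>i j p U e. p \<in> cdom P i \<and> \<phi> p \<in> cdom Q j \<and>
        coord P i p \<in> U \<and> U \<subseteq> crange P i \<and> orthonormal_frame (gcoeffs P i) U e \<longrightarrow>
        f_bitension (gcoeffs P i) (gcoeffs Q j) e (f \<circ> cinv P i) (map_coord P Q \<phi> i j)
          (coord P i p) = 0)"

definition nontrivial_f_biharmonic ::
  "('i, 'p::topological_space, 'a::euclidean_space) riem \<Rightarrow>
    ('j, 'q::topological_space, 'b::euclidean_space) riem \<Rightarrow> ('p \<Rightarrow> real) \<Rightarrow> ('p \<Rightarrow> 'q) \<Rightarrow> bool" where
  "nontrivial_f_biharmonic P Q f \<phi> \<longleftrightarrow>
     f_biharmonic P Q f \<phi> \<and> \<not> f constant_on UNIV \<and> \<not> harmonic P Q \<phi>"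

text \<open>\<open>M \<times>\<^sub>\<lambda> N\<close> with the product charts and the metric \<open>g \<oplus> \<lambda>\<^sup>2 h\<close>.\<close>

definition warped_product :: "('i, 'p, 'a::euclidean_space) riem \<Rightarrow> ('p \<Rightarrow> real) \<Rightarrow>
    ('j, 'q, 'b::euclidean_space) riem \<Rightarrow> ('i \<times> 'j, 'p \<times> 'q, 'a \<times> 'b) riem" where
  "warped_product M lam N =
     \<lparr> cdom = (\<lambda>(i, j). cdom M i \<times> cdom N j),
       coord = (\<lambda>(i, j) (x, y). (coord M i x, coord N j y)),
       gcoeffs = (\<lambda>(i, j) (z, w) (u, u') (v, v').
         gcoeffs M i z u v + (lam (cinv M i z))\<^sup>2 * gcoeffs N j w u' v') \<rparr>"


section \<open>Existence of orthonormal frames\<close>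

text \<open>Gram--Schmidt, on the whole of a coordinate domain. In particular the quantifications over
  local orthonormal frames above are not vacuous.\<close>

lemma Ck_on_Suc: "open S \<Longrightarrow> Ck_on (Suc k) S f \<Longrightarrow> Ck_on k S f"
  by (induction k arbitrary: f)
    (auto intro!: continuous_at_imp_continuous_on differentiable_imp_continuous_within)

lemma Ck_on_cong:
  assumes "open S" "\<And>x. x \<in> S \<Longrightarrow> f x = g x"
  shows "Ck_on k S f \<Longrightarrow> Ck_on k S g"
  using assms(2)
proof (induction k arbitrary: f g)
  case 0 then show ?case by (auto intro: continuous_on_eq)
next
  case (Suc k)
  have D: "(g has_derivative frechet_derivative f (at x)) (at x)" if "x \<in> S" for x
    using Suc.prems that assms(1)
    by (auto simp: frechet_derivative_works intro!: has_derivative_transform_within_open[of f _ x UNIV S g])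
  then have E: "frechet_derivative f (at x) = frechet_derivative g (at x)" if "x \<in> S" for x
    using that frechet_derivative_at by blast
  have "Ck_on k S (\<lambda>x. frechet_derivative g (at x) v)" for v
    using Suc.IH[of "\<lambda>x. frechet_derivative f (at x) v" "\<lambda>x. frechet_derivative g (at x) v"] Suc.prems E by simp
  with D show ?case by (auto simp: differentiable_def)
qed

lemma Ck_on_const: "Ck_on k S (\<lambda>x. c)"
  by (induction k arbitrary: c) auto

lemma Ck_on_add:
  assumes "open S" shows "Ck_on k S f \<Longrightarrow> Ck_on k S g \<Longrightarrow> Ck_on k S (\<lambda>x. f x + g x)"
proof (induction k arbitrary: f g)
  case 0 then show ?case by (auto intro: continuous_intros)
next
  case (Suc k)
  have D: "((\<lambda>x. f x + g x) has_derivative (\<lambda>v. frechet_derivative f (at x) v + frechet_derivative g (at x) v)) (at x)"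
    if "x \<in> S" for x
    using Suc.prems that by (auto intro!: has_derivative_add simp: frechet_derivative_works)
  have "Ck_on k S (\<lambda>x. frechet_derivative (\<lambda>x. f x + g x) (at x) v)" for v
  proof (rule Ck_on_cong[OF assms])
    show "Ck_on k S (\<lambda>x. frechet_derivative f (at x) v + frechet_derivative g (at x) v)"
      using Suc by auto
  qed (simp add: frechet_derivative_at[OF D, symmetric])
  then show ?case using D by (auto simp: differentiable_def)
qed

lemma Ck_on_scaleR:
  fixes f :: "_ \<Rightarrow> real"
  assumes "open S" shows "Ck_on k S f \<Longrightarrow> Ck_on k S g \<Longrightarrow> Ck_on k S (\<lambda>x. f x *\<^sub>R g x)"
proof (induction k arbitrary: f g)
  case 0 then show ?case by (auto intro: continuous_intros)
next
  case (Suc k)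
  have D: "((\<lambda>x. f x *\<^sub>R g x) has_derivative (\<lambda>v. f x *\<^sub>R frechet_derivative g (at x) v + frechet_derivative f (at x) v *\<^sub>R g x)) (at x)"
    if "x \<in> S" for x
    using Suc.prems that by (auto intro!: has_derivative_scaleR simp: frechet_derivative_works)
  have "Ck_on k S (\<lambda>x. frechet_derivative (\<lambda>x. f x *\<^sub>R g x) (at x) v)" for v
  proof (rule Ck_on_cong[OF assms])
    show "Ck_on k S (\<lambda>x. f x *\<^sub>R frechet_derivative g (at x) v + frechet_derivative f (at x) v *\<^sub>R g x)"
      using Suc Ck_on_Suc[OF assms Suc.prems(1)] Ck_on_Suc[OF assms Suc.prems(2)]
      by (intro Ck_on_add assms Suc.IH) auto
  qed (simp add: frechet_derivative_at[OF D, symmetric])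
  then show ?case using D by (auto simp: differentiable_def)
qed

lemma Ck_on_inv_sqrt:
  fixes f :: "_ \<Rightarrow> real"
  assumes "open S" "\<And>x. x \<in> S \<Longrightarrow> f x > 0" shows "Ck_on k S f \<Longrightarrow> Ck_on k S (\<lambda>x. inverse (sqrt (f x)))"
proof (induction k)
  case 0 then show ?case using assms(2) by (force intro!: continuous_intros)
next
  case (Suc k)
  let ?h = "\<lambda>x. inverse (sqrt (f x))"
  have D: "(?h has_derivative (\<lambda>v. (- 1/2) *\<^sub>R (?h x *\<^sub>R (?h x *\<^sub>R (?h x *\<^sub>R frechet_derivative f (at x) v))))) (at x)"
    if "x \<in> S" for x
  proof -
    have F: "(f has_derivative frechet_derivative f (at x)) (at x)" 
      using Suc.prems that by (auto simp: frechet_derivative_works)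
    have "((\<lambda>y. inverse (sqrt y)) has_real_derivative (- 1/2 * ?h x * ?h x * ?h x)) (at (f x))"
      using assms(2)[OF that] by (auto intro!: derivative_eq_intros simp: field_simps power2_eq_square)
    from has_derivative_compose[OF F this[unfolded has_field_derivative_def]]
    show ?thesis by (simp add: mult.assoc)
  qed
  have "Ck_on k S (\<lambda>x. frechet_derivative ?h (at x) v)" for v
  proof (rule Ck_on_cong[OF assms(1)])
    show "Ck_on k S (\<lambda>x. (- 1/2) *\<^sub>R (?h x *\<^sub>R (?h x *\<^sub>R (?h x *\<^sub>R frechet_derivative f (at x) v))))"
      using Suc Ck_on_Suc[OF assms(1) Suc.prems(1)]
      by (intro Ck_on_scaleR assms(1) Ck_on_const Suc.IH) auto
  qed (simp add: frechet_derivative_at[OF D, symmetric])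
  then show ?case using D by (auto simp: differentiable_def)
qed

lemma Ck_on_linear:
  fixes L :: "'b::real_normed_vector \<Rightarrow> 'c::real_normed_vector"
  assumes "open S" "bounded_linear L" shows "Ck_on k S f \<Longrightarrow> Ck_on k S (\<lambda>x. L (f x))"
proof (induction k arbitrary: f)
  case 0 then show ?case using assms(2) by (auto intro: bounded_linear.continuous_on)
next
  case (Suc k)
  have D: "((\<lambda>x. L (f x)) has_derivative (\<lambda>v. L (frechet_derivative f (at x) v))) (at x)"
    if "x \<in> S" for x
    using Suc.prems that by (auto intro!: bounded_linear.has_derivative[OF assms(2)] simp: frechet_derivative_works)
  have "Ck_on k S (\<lambda>x. frechet_derivative (\<lambda>x. L (f x)) (at x) v)" for v
  proof (rule Ck_on_cong[OF assms(1)])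
    show "Ck_on k S (\<lambda>x. L (frechet_derivative f (at x) v))" using Suc by auto
  qed (simp add: frechet_derivative_at[OF D, symmetric])
  then show ?case using D by (auto simp: differentiable_def)
qed

lemma Ck_on_sum:
  assumes "open S" "finite A" "\<And>a. a \<in> A \<Longrightarrow> Ck_on k S (f a)"
  shows "Ck_on k S (\<lambda>x. \<Sum>a\<in>A. f a x)"
  using assms(2,3)
  by (induction A rule: finite_induct) (simp_all add: Ck_on_const Ck_on_add assms(1))

lemma smooth_on_metric:
  fixes G :: "'a::euclidean_space metric_coeffs"
  assumes "open S" "\<And>u v. smooth_on S (\<lambda>z. G z u v)" "\<And>z. z \<in> S \<Longrightarrow> bilinear (G z)"
    "smooth_on S X" "smooth_on S Y"
  shows "smooth_on S (\<lambda>z. G z (X z) (Y z))"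
  unfolding smooth_on_def
proof
  fix k
  have "Ck_on k S (\<lambda>z. \<Sum>b\<in>Basis. \<Sum>c\<in>Basis. (X z \<bullet> b) *\<^sub>R (Y z \<bullet> c) *\<^sub>R G z b c)"
    using assms(2,4,5) unfolding smooth_on_def
    by (intro Ck_on_sum Ck_on_scaleR assms(1) finite_Basis Ck_on_linear[of _ "\<lambda>x. x \<bullet> _"] bounded_linear_inner_left) auto
  moreover have "(\<Sum>b\<in>Basis. \<Sum>c\<in>Basis. (X z \<bullet> b) *\<^sub>R (Y z \<bullet> c) *\<^sub>R G z b c) = G z (X z) (Y z)" if "z \<in> S" for z
  proof -
    from assms(3)[OF that] have l: "linear (\<lambda>u. G z u v)" "linear (G z v)" for v by (auto simp: bilinear_def)
    have "G z (X z) (Y z) = G z (\<Sum>b\<in>Basis. (X z \<bullet> b) *\<^sub>R b) (\<Sum>c\<in>Basis. (Y z \<bullet> c) *\<^sub>R c)"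
      by (simp add: euclidean_representation)
    also have "\<dots> = (\<Sum>b\<in>Basis. \<Sum>c\<in>Basis. (X z \<bullet> b) *\<^sub>R (Y z \<bullet> c) *\<^sub>R G z b c)"
      by (simp add: linear_sum[OF l(1)] linear_sum[OF l(2)] linear_cmul[OF l(1)] linear_cmul[OF l(2)] sum_distrib_left)
        (subst sum.swap, simp add: mult.left_commute)
    finally show ?thesis by simp
  qed
  ultimately show "Ck_on k S (\<lambda>z. G z (X z) (Y z))" by (rule Ck_on_cong[OF assms(1), rotated])
qed

lemma orthonormal_frame_exists:
  fixes G :: "'a::euclidean_space metric_coeffs"
  assumes "open S" "\<And>u v. smooth_on S (\<lambda>z. G z u v)" "\<And>z. z \<in> S \<Longrightarrow> bilinear (G z)"
    "\<And>z u v. z \<in> S \<Longrightarrow> G z u v = G z v u" "\<And>z u. z \<in> S \<Longrightarrow> u \<noteq> 0 \<Longrightarrow> G z u u > 0"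
  shows "\<exists>e. orthonormal_frame G S e"
proof -
  have "\<exists>e. (\<forall>b\<in>B. smooth_on S (e b)) \<and>
     (\<forall>z\<in>S. \<forall>b\<in>B. e b z \<in> span B \<and> (\<forall>c\<in>B. G z (e b z) (e c z) = (if b = c then 1 else 0)))"
    if "B \<subseteq> Basis" for B :: "'a set"
    using finite_subset[OF that finite_Basis] that
  proof (induction B rule: finite_induct)
    case empty then show ?case by auto
  next
    case (insert c B)
    from insert.IH insert.prems obtain e where e0: "\<forall>b\<in>B. smooth_on S (e b)" "\<forall>z\<in>S. \<forall>b\<in>B. e b z \<in> span B \<and> (\<forall>c\<in>B. G z (e b z) (e c z) = (if b = c then 1 else 0))" by auto
    then have e: "\<And>b. b\<in>B \<Longrightarrow> smooth_on S (e b)" 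
      "\<And>z b. z\<in>S \<Longrightarrow> b\<in>B \<Longrightarrow> e b z \<in> span B" 
      "\<And>z b c. z\<in>S \<Longrightarrow> b\<in>B \<Longrightarrow> c \<in> B \<Longrightarrow> G z (e b z) (e c z) = (if b = c then 1 else 0)" by simp_all
    define w where "w z = c + (\<Sum>b\<in>B. (- G z c (e b z)) *\<^sub>R e b z)" for z
    define N where "N z = inverse (sqrt (G z (w z) (w z)))" for z
    have sm: "smooth_on S (\<lambda>z. G z c (e b z))" if "b \<in> B" for b
      using smooth_on_metric[OF assms(1-3), of "\<lambda>_. c" "e b"] e(1)[OF that] Ck_on_const by (auto simp: smooth_on_def)
    have sw: "smooth_on S w"
      unfolding smooth_on_def
    proof
      fix k
      have "Ck_on k S (\<lambda>z. c + (\<Sum>b\<in>B. (-1) *\<^sub>R G z c (e b z) *\<^sub>R e b z))"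
        using e(1) sm unfolding smooth_on_def
        by (intro Ck_on_add Ck_on_const Ck_on_sum Ck_on_scaleR assms(1) insert.hyps(1)) auto
      then show "Ck_on k S w" by (simp add: w_def[abs_def])
    qed
    have w0: "w z \<noteq> 0" if "z \<in> S" for z
    proof
      assume "w z = 0"
      then have "c = - (\<Sum>b\<in>B. (- G z c (e b z)) *\<^sub>R e b z)" by (simp add: w_def eq_neg_iff_add_eq_0)
      moreover have "\<dots> \<in> span B" using e(2)[OF that] by (intro span_neg span_sum span_scale) auto
      ultimately have "c \<in> span B" by simp
      moreover have "independent (insert c B)" using insert.prems independent_Basis independent_mono by blast
      ultimately show False using insert.hyps(2) by (simp add: independent_insert)
    qed
    have pos: "G z (w z) (w z) > 0" if "z \<in> S" for z using assms(5)[OF that w0[OF that]] .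
    have sN: "smooth_on S N"
      using smooth_on_metric[OF assms(1-3) sw sw] Ck_on_inv_sqrt[OF assms(1), of "\<lambda>z. G z (w z) (w z)"] pos
      unfolding smooth_on_def N_def[abs_def] by blast
    define e' where "e' b = (if b = c then (\<lambda>z. N z *\<^sub>R w z) else e b)" for b
    have ort: "G z (w z) (e b z) = 0" if "z \<in> S" "b \<in> B" for z b
    proof -
      from assms(3)[OF that(1)] have l: "linear (\<lambda>u. G z u v)" for v by (auto simp: bilinear_def)
      have "G z (w z) (e b z) = G z c (e b z) + (\<Sum>b'\<in>B. - G z c (e b' z) * G z (e b' z) (e b z))"
        by (simp add: w_def linear_add[OF l] linear_sum[OF l] linear_cmul[OF l] linear_neg[OF l])
      also have "(\<Sum>b'\<in>B. - G z c (e b' z) * G z (e b' z) (e b z)) = (\<Sum>b'\<in>B. if b' = b then - G z c (e b' z) else 0)"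
        by (intro sum.cong refl) (use e(3) that in auto)
      also have "\<dots> = - G z c (e b z)" using that insert.hyps(1) by simp
      finally show ?thesis by simp
    qed
    have "\<forall>b\<in>insert c B. smooth_on S (e' b)"
      using e(1) sN sw insert.hyps(2)
      by (auto simp: e'_def smooth_on_def intro!: Ck_on_scaleR[OF assms(1)])
    moreover have "e' b z \<in> span (insert c B)" if "z \<in> S" "b \<in> insert c B" for z b
    proof -
      have "e a z \<in> span (insert c B)" if "a \<in> B" for a
        using e(2)[OF \<open>z \<in> S\<close> that] span_mono[of B "insert c B"] by auto
      then have "w z \<in> span (insert c B)" unfolding w_def
        by (intro span_add span_sum span_scale) (auto intro: span_base)
      then show ?thesis using that \<open>\<And>a. a \<in> B \<Longrightarrow> e a z \<in> _\<close> by (auto simp: e'_def intro: span_scale)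
    qed
    moreover have "G z (e' a z) (e' b z) = (if a = b then 1 else 0)" if "z \<in> S" "a \<in> insert c B" "b \<in> insert c B" for z a b
    proof -
      from assms(3)[OF that(1)] have l: "linear (\<lambda>u. G z u v)" "linear (G z v)" for v by (auto simp: bilinear_def)
      have "G z (N z *\<^sub>R w z) (N z *\<^sub>R w z) = 1" using pos[OF that(1)]
        by (simp add: linear_cmul[OF l(1)] linear_cmul[OF l(2)] N_def field_simps)
      moreover have "G z (N z *\<^sub>R w z) (e b z) = 0" "G z (e b z) (N z *\<^sub>R w z) = 0" if "b \<in> B" for b
        using ort[OF \<open>z \<in> S\<close> that] assms(4)[OF \<open>z \<in> S\<close>, of "e b z" "w z"]
        by (simp_all add: linear_cmul[OF l(1)] linear_cmul[OF l(2)])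
      ultimately show ?thesis using that e(3)[OF that(1)] insert.hyps(2) by (auto simp: e'_def)
    qed
    ultimately show ?case by blast
  qed
  from this[of Basis] show ?thesis using assms(1) by (auto simp: orthonormal_frame_def)
qed

lemma orthonormal_frame_exists_chart:
  assumes "riemannian_manifold M"
  shows "\<exists>e. orthonormal_frame (gcoeffs M i) (crange M i) e"
  using assms unfolding riemannian_manifold_def smooth_atlas_def riemannian_metric_def
  by (intro orthonormal_frame_exists) blast+

end

theory Submission
  imports Defs
begin

text \<open>Let \<open>V = grad log \<lambda>\<close> and \<open>n = dim N\<close>. The horizontal part of the Levi-Civita connection of
  \<open>g \<oplus> \<lambda>\<^sup>2 h\<close> is that of \<open>g\<close> minus \<open>\<lambda>\<^sup>2 h \<otimes> V\<close>; hence \<open>\<nabla>d\<pi> = \<lambda>\<^sup>2 h \<otimes> V\<close> and \<open>\<tau>(\<pi>) = n V\<close>, which does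
  not vanish identically because \<open>\<lambda>\<close> is not constant. For the same reason the vertical directions
  contribute \<open>n \<nabla>\<^sub>V V = n/2 grad |V|\<^sup>2\<close> to the trace Laplacian of \<open>V \<circ> \<pi>\<close>, and the product rule for
  \<open>f V\<close> gives that \<open>\<tau>\<^sub>2\<^sub>,\<^sub>f(\<pi>)\<close> is \<open>-n\<close> times the left-hand side of the claimed equation.

  All traces are traces of bilinear forms and are therefore independent of the orthonormal frame, so
  that frames adapted to the product may be used. When \<open>\<pi>\<close> is expressed in a chart of \<open>M\<close> other than
  the one underlying the product chart, it is followed by a transition map, a local isometry; the
  Levi-Civita connection, and with it \<open>\<tau>\<^sub>2\<^sub>,\<^sub>f\<close>, is natural under such maps.\<close>

section \<open>Calculus of smooth functions\<close>

text \<open>\<open>christoffel\<close> and \<open>grad\<close> are definite descriptions: a Riesz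
  argument at each point gives them meaning, and expansion in a smooth orthonormal frame shows that
  they are smooth. Traces are given through frame fields, whose derivatives hide tensoriality; each
  operator is therefore rewritten as a bilinear form on constant vectors, the derivatives of the
  frame cancelling. Symmetry of second derivatives carries most of the geometry: it makes the
  Hessian symmetric, turns commutators of derivatives along a map into curvature, and gives
  naturality under isometries. Only the horizontal component of the warped connection is computed,
  because the differential of the projection annihilates the vertical one. A change of target chart
  merely has to preserve vanishing of the bitension, and the factor \<open>-n\<close> cancels
  because \<open>n\<close> is positive.\<close>

lemma deriv_at_eqI: "(f has_derivative D) (at z) \<Longrightarrow> frechet_derivative f (at z) = D"
  using frechet_derivative_at by metis

lemma has_derivative_deriv_at:
  "f differentiable at z \<Longrightarrow> (f has_derivative frechet_derivative f (at z)) (at z)"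
  by (simp add: frechet_derivative_works)

lemma has_derivative_cong_open:
  assumes "open S" "z \<in> S" "\<And>x. x \<in> S \<Longrightarrow> f x = g x"
  shows "(f has_derivative D) (at z) \<longleftrightarrow> (g has_derivative D) (at z)"
  using has_derivative_transform_within_open[OF _ assms(1,2), of f D UNIV g]
    has_derivative_transform_within_open[OF _ assms(1,2), of g D UNIV f] assms(3) by auto

lemma deriv_at_cong:
  assumes "open S" "z \<in> S" "\<And>x. x \<in> S \<Longrightarrow> f x = g x"
  shows "frechet_derivative f (at z) = frechet_derivative g (at z)"
  unfolding frechet_derivative_def using has_derivative_cong_open[OF assms] by simp

lemma linear_deriv_at: "f differentiable at z \<Longrightarrow> linear (frechet_derivative f (at z))"
  by (rule linear_frechet_derivative)

lemma deriv_at_const [simp]: "deriv_at (\<lambda>x. c) z v = 0"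
  by (simp add: deriv_at_eqI[OF has_derivative_const])

lemma deriv_at_ident [simp]: "deriv_at (\<lambda>x. x) z v = v"
  by (simp add: deriv_at_eqI[OF has_derivative_ident])

lemma deriv_at_add:
  "f differentiable at z \<Longrightarrow> g differentiable at z \<Longrightarrow>
    deriv_at (\<lambda>x. f x + g x) z v = deriv_at f z v + deriv_at g z v"
  by (rule fun_cong[OF deriv_at_eqI]) (intro has_derivative_add has_derivative_deriv_at)

lemma deriv_at_scaleR:
  fixes f :: "_ \<Rightarrow> real"
  shows "f differentiable at z \<Longrightarrow> g differentiable at z \<Longrightarrow>
    deriv_at (\<lambda>x. f x *\<^sub>R g x) z v = deriv_at f z v *\<^sub>R g z + f z *\<^sub>R deriv_at g z v"
  by (subst fun_cong[OF deriv_at_eqI[OF has_derivative_scaleR[OF has_derivative_deriv_at has_derivative_deriv_at]]])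
    auto

lemma deriv_at_bounded_linear:
  "bounded_linear L \<Longrightarrow> f differentiable at z \<Longrightarrow> deriv_at (\<lambda>x. L (f x)) z v = L (deriv_at f z v)"
  using fun_cong[OF deriv_at_eqI[OF bounded_linear.has_derivative[OF _ has_derivative_deriv_at]], of L f z v]
  by blast

lemma has_derivative_compose_deriv_at:
  "f differentiable at z \<Longrightarrow> g differentiable at (f z) \<Longrightarrow>
    ((\<lambda>x. g (f x)) has_derivative (\<lambda>v. deriv_at g (f z) (deriv_at f z v))) (at z)"
  using has_derivative_compose[OF has_derivative_deriv_at has_derivative_deriv_at] by blast

lemma deriv_at_compose:
  "f differentiable at z \<Longrightarrow> g differentiable at (f z) \<Longrightarrow>
    deriv_at (\<lambda>x. g (f x)) z v = deriv_at g (f z) (deriv_at f z v)"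
  using deriv_at_eqI[OF has_derivative_compose_deriv_at[of f z g]] by simp

lemma differentiable_compose_at:
  fixes f :: "'a::euclidean_space \<Rightarrow> 'b::euclidean_space" and g :: "'b \<Rightarrow> 'c::real_normed_vector"
  assumes "f differentiable at z" "g differentiable at (f z)"
  shows "(\<lambda>x. g (f x)) differentiable at z"
  using has_derivative_compose_deriv_at[OF assms] unfolding differentiable_def by blast

section \<open>Families of linear and bilinear maps\<close>

lemma linear_Basis_expand:
  fixes L :: "'a::euclidean_space \<Rightarrow> 'b::real_vector"
  assumes "linear L"
  shows "L v = (\<Sum>b\<in>Basis. (v \<bullet> b) *\<^sub>R L b)"
proof -
  have "L v = L (\<Sum>b\<in>Basis. (v \<bullet> b) *\<^sub>R b)" by (simp add: euclidean_representation)
  then show ?thesis by (simp add: linear_sum[OF assms] linear_cmul[OF assms])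
qed

text \<open>On \<open>S\<close> the vector \<open>L x (X x)\<close> is the finite sum of the terms
  \<open>(X x \<bullet> b) *\<^sub>R L x b\<close>, so the product rule for each \<open>b\<close>
  suffices and the dependence of \<open>L\<close> on \<open>x\<close> is tested on fixed vectors
  only. Metrics, Christoffel symbols and differentials of maps are differentiated along fields in
  this way.\<close>

lemma
  fixes L :: "'a::euclidean_space \<Rightarrow> 'b::euclidean_space \<Rightarrow> 'c::real_normed_vector"
  assumes "open S" "z \<in> S" "\<And>x. x \<in> S \<Longrightarrow> linear (L x)"
    "\<And>b. (\<lambda>x. L x b) differentiable at z" "X differentiable at z"
  shows differentiable_linear_family: "(\<lambda>x. L x (X x)) differentiable at z"
    and deriv_at_linear_family:
      "deriv_at (\<lambda>x. L x (X x)) z u = deriv_at (\<lambda>x. L x (X z)) z u + L z (deriv_at X z u)"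
proof -
  have gen: "((\<lambda>x. L x (Y x)) has_derivative
      (\<lambda>u. \<Sum>b\<in>Basis. (Y z \<bullet> b) *\<^sub>R deriv_at (\<lambda>x. L x b) z u + (deriv_at Y z u \<bullet> b) *\<^sub>R L z b)) (at z)"
    if "Y differentiable at z" for Y
  proof -
    have "((\<lambda>x. \<Sum>b\<in>Basis. (Y x \<bullet> b) *\<^sub>R L x b) has_derivative
      (\<lambda>u. \<Sum>b\<in>Basis. (Y z \<bullet> b) *\<^sub>R deriv_at (\<lambda>x. L x b) z u + (deriv_at Y z u \<bullet> b) *\<^sub>R L z b)) (at z)"
      by (intro has_derivative_sum has_derivative_scaleR has_derivative_inner_left
          has_derivative_deriv_at that assms(4))
    then show ?thesis
      by (rule has_derivative_transform_within_open[OF _ assms(1,2)])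
        (metis linear_Basis_expand assms(3))
  qed
  show "(\<lambda>x. L x (X x)) differentiable at z" using gen[OF assms(5)] differentiableI by blast
  have "deriv_at (\<lambda>x. L x (X z)) z u = (\<Sum>b\<in>Basis. (X z \<bullet> b) *\<^sub>R deriv_at (\<lambda>x. L x b) z u)"
    using fun_cong[OF deriv_at_eqI[OF gen[of "\<lambda>_. X z"]], of u] by simp
  then show "deriv_at (\<lambda>x. L x (X x)) z u = deriv_at (\<lambda>x. L x (X z)) z u + L z (deriv_at X z u)"
    using fun_cong[OF deriv_at_eqI[OF gen[OF assms(5)]], of u]
      linear_Basis_expand[OF assms(3)[OF assms(2)], of "deriv_at X z u"]
    by (simp add: sum.distrib)
qed

lemma
  fixes B :: "'a::euclidean_space \<Rightarrow> 'b::euclidean_space \<Rightarrow> 'd::euclidean_space \<Rightarrow> 'c::real_normed_vector"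
  assumes "open S" "z \<in> S" "\<And>x. x \<in> S \<Longrightarrow> bilinear (B x)"
    "\<And>b c. (\<lambda>x. B x b c) differentiable at z" "X differentiable at z" "Y differentiable at z"
  shows differentiable_bilinear_family: "(\<lambda>x. B x (X x) (Y x)) differentiable at z"
    and deriv_at_bilinear_family:
      "deriv_at (\<lambda>x. B x (X x) (Y x)) z u =
        deriv_at (\<lambda>x. B x (X z) (Y z)) z u + B z (deriv_at X z u) (Y z) + B z (X z) (deriv_at Y z u)"
proof -
  have l: "linear (\<lambda>a. B x a c)" "linear (B x a)" if "x \<in> S" for x a c
    using assms(3)[OF that] by (auto simp: bilinear_def)
  have 1: "(\<lambda>x. B x (X x) c) differentiable at z" for c
    by (rule differentiable_linear_family[OF assms(1,2) l(1) assms(4,5)])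
  show "(\<lambda>x. B x (X x) (Y x)) differentiable at z"
    by (rule differentiable_linear_family[OF assms(1,2) l(2) 1 assms(6)])
  show "deriv_at (\<lambda>x. B x (X x) (Y x)) z u =
        deriv_at (\<lambda>x. B x (X z) (Y z)) z u + B z (deriv_at X z u) (Y z) + B z (X z) (deriv_at Y z u)"
    using deriv_at_linear_family[OF assms(1,2) l(2) 1 assms(6), of u]
      deriv_at_linear_family[OF assms(1,2) l(1) assms(4,5), of "Y z" u] by simp
qed

section \<open>Closure properties of smooth functions\<close>

lemma Ck_on_subset: "Ck_on k S f \<Longrightarrow> T \<subseteq> S \<Longrightarrow> Ck_on k T f"
  by (induction k arbitrary: f) (auto intro: continuous_on_subset)

lemma smooth_on_subset: "smooth_on S f \<Longrightarrow> T \<subseteq> S \<Longrightarrow> smooth_on T f"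
  by (auto simp: smooth_on_def intro: Ck_on_subset)

lemma smooth_on_cong: "open S \<Longrightarrow> smooth_on S f \<Longrightarrow> (\<And>x. x \<in> S \<Longrightarrow> f x = g x) \<Longrightarrow> smooth_on S g"
  unfolding smooth_on_def using Ck_on_cong[of S f g] by blast

lemma smooth_on_differentiable: "smooth_on S f \<Longrightarrow> x \<in> S \<Longrightarrow> f differentiable at x"
  unfolding smooth_on_def using Ck_on.simps(2)[of 0 S f] by blast

lemma smooth_on_continuous: "smooth_on S f \<Longrightarrow> continuous_on S f"
  unfolding smooth_on_def using Ck_on.simps(1)[of S f] by blast

lemma smooth_on_deriv: "smooth_on S f \<Longrightarrow> smooth_on S (\<lambda>x. deriv_at f x v)"
  unfolding smooth_on_def using Ck_on.simps(2)[of _ S f] by blast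

lemma smooth_on_const: "smooth_on S (\<lambda>x. c)"
  by (simp add: smooth_on_def Ck_on_const)

lemma smooth_on_ident: "smooth_on S (\<lambda>x. x)"
proof -
  have "Ck_on k S (\<lambda>x. x)" for k by (cases k) (auto simp: Ck_on_const)
  then show ?thesis by (simp add: smooth_on_def)
qed

lemma smooth_on_bounded_linear:
  "open S \<Longrightarrow> bounded_linear L \<Longrightarrow> smooth_on S f \<Longrightarrow> smooth_on S (\<lambda>x. L (f x))"
  by (simp add: smooth_on_def Ck_on_linear)

lemma smooth_on_add:
  "open S \<Longrightarrow> smooth_on S f \<Longrightarrow> smooth_on S g \<Longrightarrow> smooth_on S (\<lambda>x. f x + g x)"
  by (simp add: smooth_on_def Ck_on_add)

lemma smooth_on_scaleR:
  fixes f :: "_ \<Rightarrow> real"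
  shows "open S \<Longrightarrow> smooth_on S f \<Longrightarrow> smooth_on S g \<Longrightarrow> smooth_on S (\<lambda>x. f x *\<^sub>R g x)"
  by (simp add: smooth_on_def Ck_on_scaleR)

lemma smooth_on_mult:
  fixes f :: "_ \<Rightarrow> real"
  shows "open S \<Longrightarrow> smooth_on S f \<Longrightarrow> smooth_on S g \<Longrightarrow> smooth_on S (\<lambda>x. f x * g x)"
  using smooth_on_scaleR[of S f g] by simp

lemma smooth_on_diff:
  assumes "open S" "smooth_on S f" "smooth_on S g" shows "smooth_on S (\<lambda>x. f x - g x)"
  using smooth_on_add[OF assms(1,2) smooth_on_bounded_linear[OF assms(1) bounded_linear_minus[OF bounded_linear_ident] assms(3)]]
  by simp

lemma smooth_on_sum:
  "open S \<Longrightarrow> finite A \<Longrightarrow> (\<And>a. a \<in> A \<Longrightarrow> smooth_on S (f a)) \<Longrightarrow> smooth_on S (\<lambda>x. \<Sum>a\<in>A. f a x)"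
  by (simp add: smooth_on_def Ck_on_sum)

lemma smooth_on_linear_family:
  fixes L :: "'a::euclidean_space \<Rightarrow> 'b::euclidean_space \<Rightarrow> 'c::real_normed_vector"
  assumes "open S" "\<And>x. x \<in> S \<Longrightarrow> linear (L x)" "\<And>b. smooth_on S (\<lambda>x. L x b)" "smooth_on S X"
  shows "smooth_on S (\<lambda>x. L x (X x))"
proof (rule smooth_on_cong[OF assms(1)])
  show "smooth_on S (\<lambda>x. \<Sum>b\<in>Basis. (X x \<bullet> b) *\<^sub>R L x b)"
    by (intro smooth_on_sum smooth_on_scaleR smooth_on_bounded_linear[of S "\<lambda>x. x \<bullet> _"]
        bounded_linear_inner_left assms finite_Basis)
qed (metis linear_Basis_expand assms(2))

lemma smooth_on_bilinear_family:
  fixes B :: "'a::euclidean_space \<Rightarrow> 'b::euclidean_space \<Rightarrow> 'd::euclidean_space \<Rightarrow> 'c::real_normed_vector"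
  assumes "open S" "\<And>x. x \<in> S \<Longrightarrow> bilinear (B x)" "\<And>b c. smooth_on S (\<lambda>x. B x b c)"
    "smooth_on S X" "smooth_on S Y"
  shows "smooth_on S (\<lambda>x. B x (X x) (Y x))"
proof -
  have l: "linear (\<lambda>a. B x a c)" "linear (B x a)" if "x \<in> S" for x a c
    using assms(2)[OF that] by (auto simp: bilinear_def)
  have "smooth_on S (\<lambda>x. B x (X x) c)" for c
    by (rule smooth_on_linear_family[OF assms(1) l(1) assms(3,4)])
  from smooth_on_linear_family[OF assms(1) l(2) this assms(5)] show ?thesis .
qed

lemma smooth_on_deriv_field:
  fixes f :: "'a::euclidean_space \<Rightarrow> 'b::real_normed_vector"
  assumes "open S" "smooth_on S f" "smooth_on S X"
  shows "smooth_on S (\<lambda>x. deriv_at f x (X x))"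
  by (rule smooth_on_linear_family[OF assms(1) _ smooth_on_deriv[OF assms(2)] assms(3)])
    (intro linear_deriv_at smooth_on_differentiable[OF assms(2)])

text \<open>The chain rule puts the moving vector \<open>deriv_at f x v\<close> into the derivative
  of \<open>g\<close>, which \<open>Ck_on\<close> controls on fixed vectors; expanding in
  \<open>Basis\<close> separates the two. The induction generalises over \<open>g\<close> because
  the coefficients are derivatives of \<open>g\<close> composed with \<open>f\<close>.\<close>

lemma Ck_on_compose:
  fixes f :: "'a::euclidean_space \<Rightarrow> 'b::euclidean_space" and g :: "'b \<Rightarrow> 'c::real_normed_vector"
  assumes "open S" "open T" "f ` S \<subseteq> T"
  shows "Ck_on k S f \<Longrightarrow> Ck_on k T g \<Longrightarrow> Ck_on k S (\<lambda>x. g (f x))"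
proof (induction k arbitrary: g)
  case 0 then show ?case using continuous_on_compose2[OF _ _ assms(3)] by auto
next
  case (Suc k)
  have fT: "f x \<in> T" if "x \<in> S" for x using assms(3) that by auto
  have df: "f differentiable at x" "g differentiable at (f x)" if "x \<in> S" for x
    using Suc.prems fT that by auto
  have "Ck_on k S (\<lambda>x. deriv_at (\<lambda>x. g (f x)) x v)" for v
  proof (rule Ck_on_cong[OF assms(1)])
    have "Ck_on k S (\<lambda>x. deriv_at g (f x) b)" for b
      using Suc.IH[OF Ck_on_Suc[OF assms(1) Suc.prems(1)], of "\<lambda>y. deriv_at g y b"] Suc.prems(2) by simp
    then show "Ck_on k S (\<lambda>x. \<Sum>b\<in>Basis. (deriv_at f x v \<bullet> b) *\<^sub>R deriv_at g (f x) b)"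
      using Suc.prems(1)
      by (intro Ck_on_sum assms(1) finite_Basis Ck_on_scaleR Ck_on_linear[of S "\<lambda>x. x \<bullet> _"]
          bounded_linear_inner_left) auto
    show "(\<Sum>b\<in>Basis. (deriv_at f x v \<bullet> b) *\<^sub>R deriv_at g (f x) b) = deriv_at (\<lambda>x. g (f x)) x v"
      if "x \<in> S" for x
      unfolding deriv_at_compose[OF df[OF that]]
      by (rule linear_Basis_expand[OF linear_deriv_at[OF df(2)[OF that]], symmetric])
  qed
  then show ?case using df by (auto intro: differentiable_compose_at)
qed

lemma smooth_on_compose:
  fixes f :: "'a::euclidean_space \<Rightarrow> 'b::euclidean_space" and g :: "'b \<Rightarrow> 'c::real_normed_vector"
  assumes "open S" "open T" "f ` S \<subseteq> T" "smooth_on S f" "smooth_on T g"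
  shows "smooth_on S (\<lambda>x. g (f x))"
  using assms(4,5) Ck_on_compose[OF assms(1-3), of _ g] by (simp add: smooth_on_def)

lemma smooth_on_fst: "open S \<Longrightarrow> smooth_on S fst"
  using smooth_on_bounded_linear[OF _ bounded_linear_fst smooth_on_ident, of S] by simp

lemma smooth_on_snd: "open S \<Longrightarrow> smooth_on S snd"
  using smooth_on_bounded_linear[OF _ bounded_linear_snd smooth_on_ident, of S] by simp

text \<open>The reciprocal is the square of the reciprocal square root, whose regularity was
  established for Gram--Schmidt.\<close>

lemma smooth_on_inverse:
  fixes f :: "_ \<Rightarrow> real"
  assumes "open S" "smooth_on S f" "\<And>x. x \<in> S \<Longrightarrow> f x > 0"
  shows "smooth_on S (\<lambda>x. inverse (f x))"
proof (rule smooth_on_cong[OF assms(1)])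
  have "smooth_on S (\<lambda>x. inverse (sqrt (f x)))"
    using assms Ck_on_inv_sqrt[OF assms(1,3)] by (simp add: smooth_on_def)
  then show "smooth_on S (\<lambda>x. inverse (sqrt (f x)) * inverse (sqrt (f x)))"
    by (intro smooth_on_mult assms(1))
  show "inverse (sqrt (f x)) * inverse (sqrt (f x)) = inverse (f x)" if "x \<in> S" for x
    using assms(3)[OF that] by (metis inverse_mult_distrib real_sqrt_mult_self abs_of_pos)
qed

text \<open>The first derivative is \<open>inverse (f x)\<close> times that of \<open>f\<close>, a
  product of smooth functions, so a single differentiation yields all orders at once.\<close>

lemma
  fixes f :: "'a::euclidean_space \<Rightarrow> real"
  assumes "open S" "smooth_on S f" "\<And>x. x \<in> S \<Longrightarrow> f x > 0"
  shows smooth_on_ln: "smooth_on S (\<lambda>x. ln (f x))"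
    and deriv_at_ln: "x \<in> S \<Longrightarrow> deriv_at (\<lambda>x. ln (f x)) x v = inverse (f x) * deriv_at f x v"
proof -
  have D: "((\<lambda>x. ln (f x)) has_derivative (\<lambda>v. inverse (f x) * deriv_at f x v)) (at x)" if "x \<in> S" for x
    using has_derivative_compose[OF has_derivative_deriv_at[OF smooth_on_differentiable[OF assms(2) that]]
        DERIV_ln[OF assms(3)[OF that], unfolded has_field_derivative_def]] by simp
  show E: "x \<in> S \<Longrightarrow> deriv_at (\<lambda>x. ln (f x)) x v = inverse (f x) * deriv_at f x v" for x v
    using fun_cong[OF deriv_at_eqI[OF D]] by simp
  have S: "smooth_on S (\<lambda>x. deriv_at (\<lambda>x. ln (f x)) x v)" for v
    by (rule smooth_on_cong[OF assms(1) smooth_on_mult[OF assms(1) smooth_on_inverse[OF assms]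
            smooth_on_deriv[OF assms(2)]]])
      (auto simp: E)
  have "Ck_on k S (\<lambda>x. ln (f x))" for k
  proof (cases k)
    case 0
    have "(\<lambda>x. ln (f x)) differentiable at x" if "x \<in> S" for x
      using D[OF that] by (rule differentiableI)
    then show ?thesis using 0
      by (auto intro!: continuous_at_imp_continuous_on differentiable_imp_continuous_within)
  next
    case (Suc l)
    then show ?thesis using S D by (auto simp: smooth_on_def differentiable_def)
  qed
  then show "smooth_on S (\<lambda>x. ln (f x))" by (simp add: smooth_on_def)
qed

section \<open>Symmetry of second derivatives\<close>

text \<open>The second difference of \<open>f\<close> is evaluated by applying the mean value theorem in both
  directions.\<close>

lemma second_difference_mean_value:
  fixes f :: "'a::euclidean_space \<Rightarrow> real"
  assumes f: "smooth_on S f" and h: "h > 0" and S: "ball z r \<subseteq> S" and r: "h * norm u + h * norm v < r"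
  shows "\<exists>p\<in>ball z r. f (z + h *\<^sub>R u + h *\<^sub>R v) - f (z + h *\<^sub>R u) - f (z + h *\<^sub>R v) + f z
    = h * h * deriv_at (\<lambda>x. deriv_at f x u) p v"
proof -
  have B: "z + s *\<^sub>R u + t *\<^sub>R v \<in> ball z r" if "0 \<le> s" "s \<le> h" "0 \<le> t" "t \<le> h" for s t
  proof -
    have "norm (s *\<^sub>R u + t *\<^sub>R v) \<le> h * norm u + h * norm v"
      using that by (intro order.trans[OF norm_triangle_ineq] add_mono) (auto intro: mult_right_mono)
    then show ?thesis using r by (simp add: dist_norm add.assoc norm_minus_cancel[of "s *\<^sub>R u + t *\<^sub>R v", symmetric] del: norm_minus_cancel)
  qed
  have D: "((\<lambda>s. g (w + s *\<^sub>R x)) has_real_derivative deriv_at g (w + s *\<^sub>R x) x) (at s)"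
    if "g differentiable at (w + s *\<^sub>R x)" for g :: "'a \<Rightarrow> real" and w x s
  proof -
    have "((\<lambda>s. w + s *\<^sub>R x) has_derivative (\<lambda>t. t *\<^sub>R x)) (at s)"
      by (auto intro!: derivative_eq_intros)
    from has_derivative_compose[OF this has_derivative_deriv_at[OF that]]
    show ?thesis unfolding has_field_derivative_def
      by (rule has_derivative_eq_rhs) (simp add: linear_cmul[OF linear_deriv_at[OF that]] fun_eq_iff mult.commute)
  qed
  note ds = smooth_on_differentiable[OF smooth_on_subset[OF f S]]
  have "((\<lambda>s. f ((z + h *\<^sub>R v) + s *\<^sub>R u) - f (z + s *\<^sub>R u)) has_real_derivative
      deriv_at f ((z + h *\<^sub>R v) + s *\<^sub>R u) u - deriv_at f (z + s *\<^sub>R u) u) (at s)" if "0 \<le> s" "s \<le> h" for s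
    using B[OF that, of h] B[OF that, of 0] h
    by (intro DERIV_diff D ds) (simp_all add: algebra_simps)
  from MVT2[OF h this] obtain s where s: "0 < s" "s < h" and
    1: "(f ((z + h *\<^sub>R v) + h *\<^sub>R u) - f (z + h *\<^sub>R u)) - (f ((z + h *\<^sub>R v) + 0 *\<^sub>R u) - f (z + 0 *\<^sub>R u))
      = (h - 0) * (deriv_at f ((z + h *\<^sub>R v) + s *\<^sub>R u) u - deriv_at f (z + s *\<^sub>R u) u)" by auto
  have "((\<lambda>t. deriv_at f ((z + s *\<^sub>R u) + t *\<^sub>R v) u) has_real_derivative
      deriv_at (\<lambda>x. deriv_at f x u) ((z + s *\<^sub>R u) + t *\<^sub>R v) v) (at t)" if "0 \<le> t" "t \<le> h" for t
    by (rule D[where g = "\<lambda>x. deriv_at f x u"],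
        rule smooth_on_differentiable[OF smooth_on_deriv[OF smooth_on_subset[OF f S]]])
      (use B[OF _ _ that, of s] s in auto)
  from MVT2[OF h this] obtain t where t: "0 < t" "t < h" and
    2: "deriv_at f ((z + s *\<^sub>R u) + h *\<^sub>R v) u - deriv_at f ((z + s *\<^sub>R u) + 0 *\<^sub>R v) u
      = (h - 0) * deriv_at (\<lambda>x. deriv_at f x u) ((z + s *\<^sub>R u) + t *\<^sub>R v) v" by auto
  show ?thesis
  proof (rule bexI[OF _ B])
    show "f (z + h *\<^sub>R u + h *\<^sub>R v) - f (z + h *\<^sub>R u) - f (z + h *\<^sub>R v) + f z
      = h * h * deriv_at (\<lambda>x. deriv_at f x u) ((z + s *\<^sub>R u) + t *\<^sub>R v) v"
      using 1 2 by (simp add: algebra_simps)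
  qed (use s t in auto)
qed

text \<open>The second difference at \<open>z\<close> is unchanged when \<open>u\<close> and
  \<open>v\<close> are exchanged. It equals \<open>h * h\<close> times either mixed derivative,
  taken at two points close to \<open>z\<close>; by continuity both are within \<open>e / 2\<close>
  of their values at \<open>z\<close>.\<close>

lemma deriv_at_symmetric_real:
  fixes f :: "'a::euclidean_space \<Rightarrow> real"
  assumes "open S" "smooth_on S f" "z \<in> S"
  shows "deriv_at (\<lambda>x. deriv_at f x u) z v = deriv_at (\<lambda>x. deriv_at f x v) z u"
proof -
  have c: "isCont (\<lambda>x. deriv_at (\<lambda>x. deriv_at f x a) x b) z" for a b
    using smooth_on_continuous[OF smooth_on_deriv[OF smooth_on_deriv[OF assms(2)]]] assms(1,3)
    by (auto simp: continuous_on_eq_continuous_at)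
  have "\<bar>deriv_at (\<lambda>x. deriv_at f x u) z v - deriv_at (\<lambda>x. deriv_at f x v) z u\<bar> \<le> 0 + e" if "e > 0" for e
  proof -
    have near: "\<exists>r>0. \<forall>x\<in>ball z r.
       \<bar>deriv_at (\<lambda>x. deriv_at f x a) x b - deriv_at (\<lambda>x. deriv_at f x a) z b\<bar> < e / 2" for a b
    proof -
      from that have "e / 2 > 0" by simp
      with c[of a b] obtain r where "r > 0" and r: "\<And>x. dist x z < r \<Longrightarrow>
        dist (deriv_at (\<lambda>x. deriv_at f x a) x b) (deriv_at (\<lambda>x. deriv_at f x a) z b) < e / 2"
        unfolding continuous_at_eps_delta by blast
      then show ?thesis by (auto simp: dist_commute dist_real_def intro!: exI[of _ r])
    qed
    obtain r1 where r1: "r1 > 0" "\<And>x. x \<in> ball z r1 \<Longrightarrow>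
       \<bar>deriv_at (\<lambda>x. deriv_at f x u) x v - deriv_at (\<lambda>x. deriv_at f x u) z v\<bar> < e / 2"
      using near[of u v] by blast
    obtain r2 where r2: "r2 > 0" "\<And>x. x \<in> ball z r2 \<Longrightarrow>
       \<bar>deriv_at (\<lambda>x. deriv_at f x v) x u - deriv_at (\<lambda>x. deriv_at f x v) z u\<bar> < e / 2"
      using near[of v u] by blast
    obtain r3 where r3: "r3 > 0" "ball z r3 \<subseteq> S" using assms(1,3) open_contains_ball by blast
    define r where "r = min (min r1 r2) r3"
    \<comment> \<open>The extra 1 keeps the denominator positive when \<open>u\<close> and
      \<open>v\<close> vanish and makes \<open>h * norm u + h * norm v\<close> strictly smaller than
      \<open>r\<close>.\<close>
    define h where "h = r / (norm u + norm v + 1)"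
    have r: "r > 0" "ball z r \<subseteq> S" using r1 r2 r3 by (auto simp: r_def)
    have n: "norm u + norm v + 1 > 0" by (simp add: add_nonneg_pos)
    then have h: "h > 0" using r by (simp add: h_def)
    have "h * (norm u + norm v + 1) = r" using n by (simp add: h_def)
    then have hr: "h * norm u + h * norm v < r" using h by (simp add: algebra_simps)
    obtain p where p: "p \<in> ball z r" "f (z + h *\<^sub>R u + h *\<^sub>R v) - f (z + h *\<^sub>R u) - f (z + h *\<^sub>R v) + f z
        = h * h * deriv_at (\<lambda>x. deriv_at f x u) p v"
      using second_difference_mean_value[OF assms(2) h r(2) hr] by blast
    obtain q where q: "q \<in> ball z r" "f (z + h *\<^sub>R v + h *\<^sub>R u) - f (z + h *\<^sub>R v) - f (z + h *\<^sub>R u) + f z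
        = h * h * deriv_at (\<lambda>x. deriv_at f x v) q u"
      using second_difference_mean_value[OF assms(2) h r(2), of v u] hr by (auto simp: add.commute)
    have C: "z + h *\<^sub>R v + h *\<^sub>R u = z + h *\<^sub>R u + h *\<^sub>R v" by simp
    have E: "h * h * deriv_at (\<lambda>x. deriv_at f x u) p v = h * h * deriv_at (\<lambda>x. deriv_at f x v) q u"
      using p(2) q(2) unfolding C by linarith
    have "deriv_at (\<lambda>x. deriv_at f x u) p v = deriv_at (\<lambda>x. deriv_at f x v) q u"
      by (rule mult_left_cancel[THEN iffD1, OF _ E]) (use h in simp)
    moreover have "p \<in> ball z r1" "q \<in> ball z r2" using p(1) q(1) by (auto simp: r_def)
    ultimately show ?thesis using r1(2)[of p] r2(2)[of q] by linarith
  qed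
  then have "\<bar>deriv_at (\<lambda>x. deriv_at f x u) z v - deriv_at (\<lambda>x. deriv_at f x v) z u\<bar> \<le> 0"
    by (rule field_le_epsilon)
  then show ?thesis by simp
qed

lemma deriv_at_symmetric:
  fixes f :: "'a::euclidean_space \<Rightarrow> 'b::euclidean_space"
  assumes "open S" "smooth_on S f" "z \<in> S"
  shows "deriv_at (\<lambda>x. deriv_at f x u) z v = deriv_at (\<lambda>x. deriv_at f x v) z u"
proof (rule euclidean_eqI)
  fix b :: 'b
  have 1: "deriv_at (\<lambda>x. deriv_at f x p) z q \<bullet> b = deriv_at (\<lambda>x. deriv_at (\<lambda>x. f x \<bullet> b) x p) z q" for p q
  proof -
    have "deriv_at (\<lambda>x. deriv_at (\<lambda>x. f x \<bullet> b) x p) z q = deriv_at (\<lambda>x. deriv_at f x p \<bullet> b) z q"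
      by (rule fun_cong[OF deriv_at_cong[OF assms(1,3)]])
        (rule deriv_at_bounded_linear[OF bounded_linear_inner_left smooth_on_differentiable[OF assms(2)]])
    then show ?thesis
      using deriv_at_bounded_linear[OF bounded_linear_inner_left
          smooth_on_differentiable[OF smooth_on_deriv[OF assms(2)] assms(3)]] by simp
  qed
  show "deriv_at (\<lambda>x. deriv_at f x u) z v \<bullet> b = deriv_at (\<lambda>x. deriv_at f x v) z u \<bullet> b"
    unfolding 1
    by (rule deriv_at_symmetric_real[OF assms(1) _ assms(3)])
      (rule smooth_on_bounded_linear[OF assms(1) bounded_linear_inner_left assms(2)])
qed

text \<open>Linearity holds on a neighbourhood, so it survives differentiation in the base point.
  The Koszul expression and the derivative terms of the curvature owe their multilinearity to
  this.\<close>

lemma linear_deriv_at_parameter: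
  fixes L :: "'a::euclidean_space \<Rightarrow> 'b::real_vector \<Rightarrow> 'c::real_normed_vector"
  assumes "open S" "z \<in> S" "\<And>x. x \<in> S \<Longrightarrow> linear (L x)" "\<And>b. (\<lambda>x. L x b) differentiable at z"
  shows "linear (\<lambda>b. deriv_at (\<lambda>x. L x b) z u)"
proof (rule linearI)
  fix b c
  have "deriv_at (\<lambda>x. L x (b + c)) z u = deriv_at (\<lambda>x. L x b + L x c) z u"
    by (rule fun_cong[OF deriv_at_cong[OF assms(1,2)]]) (simp add: linear_add[OF assms(3)])
  then show "deriv_at (\<lambda>x. L x (b + c)) z u = deriv_at (\<lambda>x. L x b) z u + deriv_at (\<lambda>x. L x c) z u"
    by (simp add: deriv_at_add assms(4))
next
  fix r :: real and b
  have "deriv_at (\<lambda>x. L x (r *\<^sub>R b)) z u = deriv_at (\<lambda>x. r *\<^sub>R L x b) z u"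
    by (rule fun_cong[OF deriv_at_cong[OF assms(1,2)]]) (simp add: linear_cmul[OF assms(3)])
  then show "deriv_at (\<lambda>x. L x (r *\<^sub>R b)) z u = r *\<^sub>R deriv_at (\<lambda>x. L x b) z u"
    by (simp add: deriv_at_bounded_linear[OF bounded_linear_scaleR_right] assms(4))
qed

lemma bilinear_deriv_at_parameter:
  fixes B :: "'a::euclidean_space \<Rightarrow> 'b::real_vector \<Rightarrow> 'd::real_vector \<Rightarrow> 'c::real_normed_vector"
  assumes "open S" "z \<in> S" "\<And>x. x \<in> S \<Longrightarrow> bilinear (B x)" "\<And>b c. (\<lambda>x. B x b c) differentiable at z"
  shows "bilinear (\<lambda>b c. deriv_at (\<lambda>x. B x b c) z u)"
  unfolding bilinear_def
proof (intro conjI allI)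
  show "linear (\<lambda>c. deriv_at (\<lambda>x. B x b c) z u)" for b
    using assms(3) by (intro linear_deriv_at_parameter[OF assms(1,2) _ assms(4)]) (simp add: bilinear_def)
  show "linear (\<lambda>b. deriv_at (\<lambda>x. B x b c) z u)" for c
    using assms(3) by (intro linear_deriv_at_parameter[OF assms(1,2) _ assms(4)]) (simp add: bilinear_def)
qed

section \<open>Orthonormal bases of an inner product\<close>

definition orthonormal_at :: "('a::euclidean_space \<Rightarrow> 'a \<Rightarrow> real) \<Rightarrow> ('a \<Rightarrow> 'a) \<Rightarrow> bool" where
  "orthonormal_at B e \<longleftrightarrow> (\<forall>b\<in>Basis. \<forall>c\<in>Basis. B (e b) (e c) = (if b = c then 1 else 0))"

locale inner_form =
  fixes B :: "'a::euclidean_space \<Rightarrow> 'a \<Rightarrow> real"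
  assumes bilinear: "bilinear B"
    and sym: "B u v = B v u"
    and pos: "u \<noteq> 0 \<Longrightarrow> B u u > 0"
begin

lemma linear_left: "linear (\<lambda>u. B u v)" and linear_right: "linear (B u)"
  using bilinear by (auto simp: bilinear_def)

lemmas form_simps =
  linear_add[OF linear_left] linear_add[OF linear_right]
  linear_diff[OF linear_left] linear_diff[OF linear_right]
  linear_cmul[OF linear_left] linear_cmul[OF linear_right]
  linear_sum[OF linear_left] linear_sum[OF linear_right]

lemma nonneg: "B u u \<ge> 0"
  using pos[of u] by (cases "u = 0") (simp_all add: linear_0[OF linear_left])

lemma nondegenerate: "(\<And>\<xi>. B v \<xi> = B w \<xi>) \<Longrightarrow> v = w"
  using pos[of "v - w"] by (fastforce simp: form_simps)

lemma orthonormal_exists: "\<exists>e. orthonormal_at B e"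
proof -
  obtain e where "orthonormal_frame (\<lambda>_. B) UNIV e"
    using orthonormal_frame_exists[of UNIV "\<lambda>_. B"] bilinear sym pos by (auto simp: smooth_on_const)
  then have "orthonormal_at B (\<lambda>b. e b 0)"
    unfolding orthonormal_frame_def orthonormal_at_def by blast
  then show ?thesis by blast
qed

text \<open>Orthonormality makes \<open>e\<close> injective on \<open>Basis\<close> with independent
  image; having as many elements as the dimension, the image spans.\<close>

lemma orthonormal_expand:
  assumes "orthonormal_at B e"
  shows "v = (\<Sum>b\<in>Basis. B v (e b) *\<^sub>R e b)"
proof -
  have ort: "B (e b) (e c) = (if b = c then 1 else 0)" if "b \<in> Basis" "c \<in> Basis" for b c
    using assms that by (auto simp: orthonormal_at_def)
  have inj: "inj_on e Basis"
  proof (rule inj_onI)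
    show "b = c" if "b \<in> Basis" "c \<in> Basis" "e b = e c" for b c
      using ort[OF that(1,2)] ort[OF that(1,1)] that(3) by (auto split: if_splits)
  qed
  have "independent (e ` Basis)"
  proof (rule independent_if_scalars_zero)
    fix f x assume "(\<Sum>x\<in>e ` Basis. f x *\<^sub>R x) = 0" "x \<in> e ` Basis"
    then obtain c where c: "c \<in> Basis" "x = e c" and 0: "(\<Sum>b\<in>Basis. f (e b) *\<^sub>R e b) = 0"
      by (auto simp: sum.reindex[OF inj])
    have "0 = B (\<Sum>b\<in>Basis. f (e b) *\<^sub>R e b) (e c)" using 0 by (simp add: linear_0[OF linear_left])
    also have "\<dots> = (\<Sum>b\<in>Basis. if b = c then f (e b) else 0)"
      unfolding form_simps by (intro sum.cong refl) (simp add: ort c)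
    finally show "f x = 0" using c by simp
  qed simp
  moreover have "card (e ` Basis) = DIM('a)" by (rule card_image[OF inj])
  ultimately have "UNIV \<subseteq> span (e ` Basis)" by (intro card_ge_dim_independent) auto
  then have "v \<in> span (e ` Basis)" by auto
  then show ?thesis
  proof (induction rule: span_induct)
    \<comment> \<open>In this induction rule \<open>base\<close> is the closure under linear
      combinations, and \<open>step\<close> treats the spanning vectors.\<close>
    case base
    have "subspace {v. v = (\<Sum>b\<in>Basis. B v (e b) *\<^sub>R e b)}"
    proof (rule subspaceI; simp only: mem_Collect_eq)
      show "0 = (\<Sum>b\<in>Basis. B 0 (e b) *\<^sub>R e b)" by (simp add: linear_0[OF linear_left])
      show "x + y = (\<Sum>b\<in>Basis. B (x + y) (e b) *\<^sub>R e b)"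
        if "x = (\<Sum>b\<in>Basis. B x (e b) *\<^sub>R e b)" "y = (\<Sum>b\<in>Basis. B y (e b) *\<^sub>R e b)" for x y
        using that by (simp add: form_simps scaleR_add_left sum.distrib)
      show "r *\<^sub>R x = (\<Sum>b\<in>Basis. B (r *\<^sub>R x) (e b) *\<^sub>R e b)"
        if "x = (\<Sum>b\<in>Basis. B x (e b) *\<^sub>R e b)" for x r
        using arg_cong[OF that, of "scaleR r"]
        unfolding form_simps scaleR_sum_right scaleR_scaleR real_scaleR_def .
    qed
    then show ?case .
  next
    case (step x)
    then obtain c where "c \<in> Basis" "x = e c" by auto
    then show ?case by (simp add: ort if_distrib[of "\<lambda>r. r *\<^sub>R _"] cong: if_cong sum.cong)
  qed
qed

text \<open>Existence comes from the orthonormal expansion, uniqueness from nondegeneracy. This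
  legitimises the definite descriptions in \<open>grad\<close> and
  \<open>christoffel\<close>.\<close>

lemma riesz:
  fixes l :: "'a \<Rightarrow> real"
  assumes "linear l" shows "\<exists>!w. \<forall>\<xi>. B w \<xi> = l \<xi>"
proof (rule ex_ex1I)
  obtain e where e: "orthonormal_at B e" using orthonormal_exists by blast
  have "B (\<Sum>b\<in>Basis. l (e b) *\<^sub>R e b) \<xi> = l \<xi>" for \<xi>
    using arg_cong[OF orthonormal_expand[OF e, of \<xi>], of l]
    by (simp add: form_simps linear_sum[OF assms] linear_cmul[OF assms] sym[of \<xi>] mult.commute)
  then show "\<exists>w. \<forall>\<xi>. B w \<xi> = l \<xi>" by blast
qed (auto intro: nondegenerate)

text \<open>The first copy of \<open>e b\<close> is expanded in \<open>e'\<close>, the sums are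
  exchanged, and the coefficients recombine in the second slot to \<open>e' c\<close>. Values lie in
  any real vector space, so vector-valued traces such as the tension field are covered.\<close>

lemma trace_independent:
  fixes A :: "'a \<Rightarrow> 'a \<Rightarrow> 'c::real_vector"
  assumes "bilinear A" "orthonormal_at B e" "orthonormal_at B e'"
  shows "(\<Sum>b\<in>Basis. A (e b) (e b)) = (\<Sum>b\<in>Basis. A (e' b) (e' b))"
proof -
  have l: "linear (\<lambda>u. A u v)" "linear (A u)" for u v using assms(1) by (auto simp: bilinear_def)
  have "(\<Sum>b\<in>Basis. A (e b) (e b)) = (\<Sum>b\<in>Basis. A (\<Sum>c\<in>Basis. B (e b) (e' c) *\<^sub>R e' c) (e b))"
    using orthonormal_expand[OF assms(3)] by simp
  also have "\<dots> = (\<Sum>c\<in>Basis. \<Sum>b\<in>Basis. B (e' c) (e b) *\<^sub>R A (e' c) (e b))"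
    unfolding linear_sum[OF l(1)] linear_cmul[OF l(1)] by (subst sum.swap) (simp add: sym)
  also have "\<dots> = (\<Sum>c\<in>Basis. A (e' c) (\<Sum>b\<in>Basis. B (e' c) (e b) *\<^sub>R e b))"
    by (simp add: linear_sum[OF l(2)] linear_cmul[OF l(2)])
  finally show ?thesis using orthonormal_expand[OF assms(2)] by simp
qed

text \<open>\<open>divergence\<close> takes its trace in the Euclidean basis, which has no relation
  to the metric; this links it with traces over orthonormal bases of \<open>B\<close>.\<close>

lemma trace_inner:
  assumes "linear L" "orthonormal_at B e"
  shows "(\<Sum>b\<in>Basis. L b \<bullet> b) = (\<Sum>b\<in>Basis. B (L (e b)) (e b))"
proof -
  have l: "linear (\<lambda>u. B (L u) v)" for v
    using linear_compose[OF assms(1) linear_left] by (simp add: o_def)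
  have "(\<Sum>b\<in>Basis. L b \<bullet> b) = (\<Sum>b\<in>Basis. \<Sum>c\<in>Basis. B (L b) (e c) * (e c \<bullet> b))"
    by (subst orthonormal_expand[OF assms(2)]) (simp add: inner_sum_left)
  also have "\<dots> = (\<Sum>c\<in>Basis. \<Sum>b\<in>Basis. (e c \<bullet> b) *\<^sub>R B (L b) (e c))"
    by (subst sum.swap) (simp add: mult.commute)
  also have "\<dots> = (\<Sum>c\<in>Basis. B (L (e c)) (e c))"
    by (simp only: linear_Basis_expand[OF l, symmetric])
  finally show ?thesis .
qed

end

section \<open>The Levi-Civita connection in a chart\<close>

text \<open>The pull-back connection with a vector, rather than a field, as direction.
  \<open>pb_nabla\<close> reads its direction field only at \<open>z\<close>, so nothing is lost,
  and linearity in the direction can be stated.\<close>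

definition along :: "'b::euclidean_space metric_coeffs \<Rightarrow> ('a::euclidean_space \<Rightarrow> 'b) \<Rightarrow>
    ('a \<Rightarrow> 'b) \<Rightarrow> 'a \<Rightarrow> 'a \<Rightarrow> 'b" where
  "along H \<Phi> W z v = deriv_at W z v + christoffel H (\<Phi> z) (deriv_at \<Phi> z v) (W z)"

abbreviation cov :: "'a::euclidean_space metric_coeffs \<Rightarrow> ('a \<Rightarrow> 'a) \<Rightarrow> 'a \<Rightarrow> 'a \<Rightarrow> 'a" where
  "cov G \<equiv> along G (\<lambda>x. x)"

definition hessian :: "'a::euclidean_space metric_coeffs \<Rightarrow> ('a \<Rightarrow> real) \<Rightarrow> 'a \<Rightarrow> 'a \<Rightarrow> 'a \<Rightarrow> real" where
  "hessian G f z u v = deriv_at (\<lambda>x. deriv_at f x v) z u - deriv_at f z (christoffel G z u v)"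

lemma pb_nabla_eq_along: "pb_nabla H \<Phi> X W z = along H \<Phi> W z (X z)"
  by (simp add: pb_nabla_def along_def dmap_def)

lemma nabla_eq_cov: "nabla G X Y z = cov G Y z (X z)"
  by (simp add: nabla_def along_def)

locale metric_chart =
  fixes S :: "'a::euclidean_space set" and G :: "'a metric_coeffs"
  assumes open_domain: "open S"
    and inner_form: "z \<in> S \<Longrightarrow> inner_form (G z)"
    and smooth: "smooth_on S (\<lambda>z. G z u v)"
begin

lemma bilinear_G: "z \<in> S \<Longrightarrow> bilinear (G z)"
  using inner_form inner_form.bilinear by blast

lemma sym_G: "z \<in> S \<Longrightarrow> G z u v = G z v u"
  using inner_form inner_form.sym by blast

lemma differentiable_G: "z \<in> S \<Longrightarrow> (\<lambda>x. G x u v) differentiable at z"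
  using smooth smooth_on_differentiable by blast

lemma frame_exists: "\<exists>e. orthonormal_frame G S e"
  using inner_form inner_form.sym inner_form.pos
  by (intro orthonormal_frame_exists open_domain smooth bilinear_G) blast+

lemma orthonormal_frame_at: "orthonormal_frame G U e \<Longrightarrow> z \<in> U \<Longrightarrow> orthonormal_at (G z) (\<lambda>b. e b z)"
  by (auto simp: orthonormal_frame_def orthonormal_at_def)

lemma grad_inner:
  assumes "z \<in> S" "f differentiable at z" shows "G z (grad G f z) \<xi> = deriv_at f z \<xi>"
proof -
  have "\<forall>\<xi>. G z (grad G f z) \<xi> = deriv_at f z \<xi>"
    unfolding grad_def
    by (rule theI'[OF inner_form.riesz[OF inner_form[OF assms(1)] linear_deriv_at[OF assms(2)]]])
  then show ?thesis by blast
qed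

lemma grad_expand:
  assumes "z \<in> S" "f differentiable at z" "orthonormal_at (G z) e"
  shows "grad G f z = (\<Sum>b\<in>Basis. deriv_at f z (e b) *\<^sub>R e b)"
  by (subst inner_form.orthonormal_expand[OF inner_form[OF assms(1)] assms(3)])
    (simp add: grad_inner[OF assms(1,2)])

text \<open>A description taken point by point carries no regularity; the expansion in a smooth
  orthonormal frame provides it.\<close>

lemma smooth_grad:
  assumes f: "smooth_on S f" shows "smooth_on S (grad G f)"
proof -
  obtain e where e: "orthonormal_frame G S e" using frame_exists by blast
  show ?thesis
  proof (rule smooth_on_cong[OF open_domain])
    show "smooth_on S (\<lambda>z. \<Sum>b\<in>Basis. deriv_at f z (e b z) *\<^sub>R e b z)"
      using e by (intro smooth_on_sum smooth_on_scaleR smooth_on_deriv_field open_domain f finite_Basis)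
        (auto simp: orthonormal_frame_def)
    show "(\<Sum>b\<in>Basis. deriv_at f z (e b z) *\<^sub>R e b z) = grad G f z" if "z \<in> S" for z
      using grad_expand[OF that smooth_on_differentiable[OF f that] orthonormal_frame_at[OF e that]] by simp
  qed
qed

lemma linear_deriv_G_left: "z \<in> S \<Longrightarrow> linear (\<lambda>v. deriv_at (\<lambda>x. G x v w) z u)"
  and linear_deriv_G_right: "z \<in> S \<Longrightarrow> linear (\<lambda>w. deriv_at (\<lambda>x. G x v w) z u)"
  using bilinear_deriv_at_parameter[OF open_domain _ bilinear_G differentiable_G, of z u]
  by (auto simp: bilinear_def)

text \<open>The Koszul expression is linear in \<open>\<xi>\<close>, since the metric is bilinear
  near \<open>z\<close>; half of it is therefore represented by exactly one vector.\<close>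

lemma christoffel_koszul:
  assumes "z \<in> S"
  shows "2 * G z (christoffel G z u v) \<xi> =
     deriv_at (\<lambda>x. G x v \<xi>) z u + deriv_at (\<lambda>x. G x u \<xi>) z v - deriv_at (\<lambda>x. G x u v) z \<xi>"
proof -
  let ?K = "\<lambda>\<xi>. deriv_at (\<lambda>x. G x v \<xi>) z u + deriv_at (\<lambda>x. G x u \<xi>) z v - deriv_at (\<lambda>x. G x u v) z \<xi>"
  have "linear ?K"
    by (intro linear_compose_sub linear_compose_add linear_deriv_G_right linear_deriv_at differentiable_G assms)
  then have "linear (\<lambda>\<xi>. (1/2) *\<^sub>R ?K \<xi>)" by (rule linear_compose_scale_right)
  then have "\<exists>!w. \<forall>\<xi>. G z w \<xi> = (1/2) *\<^sub>R ?K \<xi>"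
    by (rule inner_form.riesz[OF inner_form[OF assms]])
  moreover have "(2 * G z w \<xi> = ?K \<xi>) \<longleftrightarrow> (G z w \<xi> = (1/2) *\<^sub>R ?K \<xi>)" for w \<xi> by auto
  ultimately have "\<exists>!w. \<forall>\<xi>. 2 * G z w \<xi> = ?K \<xi>" by simp
  from theI'[OF this] show ?thesis unfolding christoffel_def by blast
qed

lemma christoffel_sym:
  assumes "z \<in> S" shows "christoffel G z u v = christoffel G z v u"
proof -
  have "deriv_at (\<lambda>x. G x u v) z \<xi> = deriv_at (\<lambda>x. G x v u) z \<xi>" for \<xi>
    by (rule fun_cong[OF deriv_at_cong[OF open_domain assms]]) (rule sym_G)
  then show ?thesis
    using christoffel_koszul[OF assms, of u v] christoffel_koszul[OF assms, of v u]
    by (intro inner_form.nondegenerate[OF inner_form[OF assms]])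
      (smt (verit, del_insts) mult_left_cancel zero_neq_numeral)
qed

lemma linear_christoffel_right:
  assumes "z \<in> S" shows "linear (christoffel G z u)"
proof -
  interpret B: inner_form "G z" by (rule inner_form[OF assms])
  note k = christoffel_koszul[OF assms]
  note l = linear_deriv_G_left[OF assms] linear_deriv_G_right[OF assms] linear_deriv_at[OF differentiable_G[OF assms]]
  show ?thesis
  proof (rule linearI)
    fix v w
    have "2 * G z (christoffel G z u (v + w)) \<xi> = 2 * G z (christoffel G z u v + christoffel G z u w) \<xi>" for \<xi>
      unfolding B.form_simps distrib_left k
      by (simp add: linear_add[OF l(1)] linear_add[OF l(2)] linear_add[OF l(3)])
    then show "christoffel G z u (v + w) = christoffel G z u v + christoffel G z u w"
      by (intro B.nondegenerate) simp
  next
    fix r :: real and v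
    have "2 * G z (christoffel G z u (r *\<^sub>R v)) \<xi> = r * (2 * G z (christoffel G z u v) \<xi>)" for \<xi>
      unfolding k by (simp add: linear_cmul[OF l(1)] linear_cmul[OF l(2)] linear_cmul[OF l(3)] algebra_simps)
    then show "christoffel G z u (r *\<^sub>R v) = r *\<^sub>R christoffel G z u v"
      by (intro B.nondegenerate) (simp add: B.form_simps)
  qed
qed

lemma linear_christoffel_left: "z \<in> S \<Longrightarrow> linear (\<lambda>u. christoffel G z u v)"
  using linear_christoffel_right[of z v] by (simp add: christoffel_sym[of z _ v])

lemma bilinear_christoffel: "z \<in> S \<Longrightarrow> bilinear (christoffel G z)"
  by (simp add: bilinear_def linear_christoffel_left linear_christoffel_right)

lemma smooth_christoffel: "smooth_on S (\<lambda>z. christoffel G z u v)"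
proof -
  obtain e where e: "orthonormal_frame G S e" using frame_exists by blast
  let ?K = "\<lambda>z \<xi>. deriv_at (\<lambda>x. G x v \<xi>) z u + deriv_at (\<lambda>x. G x u \<xi>) z v - deriv_at (\<lambda>x. G x u v) z \<xi>"
  show ?thesis
  proof (rule smooth_on_cong[OF open_domain])
    have se: "smooth_on S (e b)" if "b \<in> Basis" for b using e that by (auto simp: orthonormal_frame_def)
    have sK: "smooth_on S (\<lambda>z. deriv_at (\<lambda>x. G x v (e b z)) z u)" if "b \<in> Basis" for v u b
      by (rule smooth_on_linear_family[OF open_domain linear_deriv_G_right smooth_on_deriv[OF smooth] se[OF that]])
    show "smooth_on S (\<lambda>z. \<Sum>b\<in>Basis. ((1/2) *\<^sub>R ?K z (e b z)) *\<^sub>R e b z)"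
      by (intro smooth_on_sum smooth_on_scaleR open_domain finite_Basis smooth_on_const smooth_on_add
          smooth_on_diff sK smooth_on_deriv_field smooth se)
    fix z assume z: "z \<in> S"
    have "christoffel G z u v = (\<Sum>b\<in>Basis. G z (christoffel G z u v) (e b z) *\<^sub>R e b z)"
      by (rule inner_form.orthonormal_expand[OF inner_form[OF z] orthonormal_frame_at[OF e z]])
    then show "(\<Sum>b\<in>Basis. ((1/2) *\<^sub>R ?K z (e b z)) *\<^sub>R e b z) = christoffel G z u v"
      by (simp add: christoffel_koszul[OF z, symmetric])
  qed
qed

lemma differentiable_christoffel: "z \<in> S \<Longrightarrow> (\<lambda>x. christoffel G x u v) differentiable at z"
  using smooth_christoffel smooth_on_differentiable by blast

text \<open>Metric compatibility on constant fields: in the sum of the Koszul formulas for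
  \<open>u, v, w\<close> and \<open>u, w, v\<close> the derivatives in the directions
  \<open>v\<close> and \<open>w\<close> cancel.\<close>

lemma deriv_G:
  assumes "z \<in> S"
  shows "deriv_at (\<lambda>x. G x v w) z u = G z (christoffel G z u v) w + G z v (christoffel G z u w)"
proof -
  have s: "deriv_at (\<lambda>x. G x a b) z c = deriv_at (\<lambda>x. G x b a) z c" for a b c
    by (rule fun_cong[OF deriv_at_cong[OF open_domain assms]]) (rule sym_G)
  show ?thesis
    using christoffel_koszul[OF assms, of u v w] christoffel_koszul[OF assms, of u w v]
      sym_G[OF assms, of v "christoffel G z u w"] s[of v w u] by linarith
qed

lemma deriv_G_fields:
  assumes "z \<in> S" "X differentiable at z" "Y differentiable at z"
  shows "deriv_at (\<lambda>x. G x (X x) (Y x)) z u = G z (cov G X z u) (Y z) + G z (X z) (cov G Y z u)"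
proof -
  interpret B: inner_form "G z" by (rule inner_form[OF assms(1)])
  show ?thesis
    using deriv_at_bilinear_family[OF open_domain assms(1) bilinear_G differentiable_G[OF assms(1)] assms(2,3), of u]
    by (simp add: along_def deriv_G[OF assms(1)] B.form_simps)
qed

lemma hessian_eq:
  assumes "z \<in> S" "smooth_on S f"
  shows "G z (cov G (grad G f) z u) v = hessian G f z u v"
proof -
  note d = smooth_on_differentiable[OF assms(2)]
  have "deriv_at (\<lambda>x. deriv_at f x v) z u = deriv_at (\<lambda>x. G x (grad G f x) v) z u"
    by (rule fun_cong[OF deriv_at_cong[OF open_domain assms(1)]]) (simp add: grad_inner d)
  also have "\<dots> = G z (cov G (grad G f) z u) v + G z (grad G f z) (cov G (\<lambda>_. v) z u)"
    by (rule deriv_G_fields[OF assms(1) smooth_on_differentiable[OF smooth_grad[OF assms(2)] assms(1)]]) simp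
  finally show ?thesis by (simp add: hessian_def grad_inner[OF assms(1) d[OF assms(1)]] along_def)
qed

lemma hessian_sym:
  assumes "z \<in> S" "smooth_on S f" shows "hessian G f z u v = hessian G f z v u"
  by (simp add: hessian_def christoffel_sym[OF assms(1), of u v]
      deriv_at_symmetric_real[OF open_domain assms(2,1), of v u])

lemma linear_cov:
  assumes "z \<in> S" "X differentiable at z" shows "linear (cov G X z)"
  unfolding along_def deriv_at_ident
  by (intro linear_compose_add linear_deriv_at linear_christoffel_left assms)

lemma laplacian_eq_trace:
  assumes "z \<in> S" "smooth_on S f" "orthonormal_at (G z) e"
  shows "laplacian G f z = (\<Sum>b\<in>Basis. hessian G f z (e b) (e b))"
  using inner_form.trace_inner[OF inner_form[OF assms(1)] linear_cov[OF assms(1)] assms(3)]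
    smooth_on_differentiable[OF smooth_grad[OF assms(2)] assms(1)]
  by (simp add: laplacian_def divergence_def nabla_eq_cov hessian_eq[OF assms(1,2)])

text \<open>Compatibility gives twice the inner product of the gradient with its derivative in
  direction \<open>\<xi>\<close>. Symmetry of the Hessian, available because the field is a
  gradient, moves \<open>\<xi>\<close> to the other slot. This 2 is the reason for the coefficient
  \<open>n/2\<close> in the equation.\<close>

lemma grad_norm_grad:
  assumes "z \<in> S" "smooth_on S f"
  shows "grad G (\<lambda>x. G x (grad G f x) (grad G f x)) z = 2 *\<^sub>R cov G (grad G f) z (grad G f z)"
proof -
  interpret B: inner_form "G z" by (rule inner_form[OF assms(1)])
  let ?V = "grad G f"
  note sV = smooth_grad[OF assms(2)]
  have "(\<lambda>x. G x (?V x) (?V x)) differentiable at z"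
    by (rule smooth_on_differentiable[OF smooth_on_bilinear_family[OF open_domain bilinear_G smooth sV sV] assms(1)])
  then have "G z (grad G (\<lambda>x. G x (?V x) (?V x)) z) \<xi> = 2 * G z (cov G ?V z \<xi>) (?V z)" for \<xi>
    using sV assms(1) sym_G[OF assms(1), of "?V z"]
    by (simp add: grad_inner[OF assms(1)] deriv_G_fields smooth_on_differentiable)
  then have "G z (grad G (\<lambda>x. G x (?V x) (?V x)) z) \<xi> = G z (2 *\<^sub>R cov G ?V z (?V z)) \<xi>" for \<xi>
    by (simp add: B.form_simps hessian_eq[OF assms] hessian_sym[OF assms, of \<xi>])
  then show ?thesis by (rule B.nondegenerate)
qed

end

section \<open>Second covariant derivatives along a map\<close>

text \<open>The second covariant derivative of a section, with \<open>v\<close> extended as a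
  constant field. By \<open>pb_nabla_pb_nabla\<close> every differentiable extension gives the same
  value.\<close>

definition second_along :: "'a::euclidean_space metric_coeffs \<Rightarrow> 'b::euclidean_space metric_coeffs \<Rightarrow>
    ('a \<Rightarrow> 'b) \<Rightarrow> ('a \<Rightarrow> 'b) \<Rightarrow> 'a \<Rightarrow> 'a \<Rightarrow> 'a \<Rightarrow> 'b" where
  "second_along G H \<Phi> W z u v =
     along H \<Phi> (\<lambda>x. along H \<Phi> W x v) z u - along H \<Phi> W z (christoffel G z u v)"

definition second_fundamental :: "'a::euclidean_space metric_coeffs \<Rightarrow> 'b::euclidean_space metric_coeffs \<Rightarrow>
    ('a \<Rightarrow> 'b) \<Rightarrow> 'a \<Rightarrow> 'a \<Rightarrow> 'a \<Rightarrow> 'b" where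
  "second_fundamental G H \<Phi> z u v =
     along H \<Phi> (\<lambda>x. deriv_at \<Phi> x v) z u - deriv_at \<Phi> z (christoffel G z u v)"

section \<open>Locality of the operators along a map\<close>

lemma along_cong:
  assumes "open S" "z \<in> S" "\<And>x. x \<in> S \<Longrightarrow> W x = W' x"
  shows "along H \<Phi> W z u = along H \<Phi> W' z u"
  using deriv_at_cong[OF assms] assms(2,3) by (simp add: along_def)

lemma along_scaleR:
  assumes "bilinear (christoffel H (\<Phi> z))" "f differentiable at z" "W differentiable at z"
  shows "along H \<Phi> (\<lambda>x. f x *\<^sub>R W x) z u = deriv_at f z u *\<^sub>R W z + f z *\<^sub>R along H \<Phi> W z u"
  using assms by (simp add: along_def deriv_at_scaleR bilinear_rmul scaleR_add_right)

lemma pb_nabla_cong: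
  assumes "open S" "z \<in> S" "\<And>x. x \<in> S \<Longrightarrow> \<Phi> x = \<Phi>' x" "\<And>x. x \<in> S \<Longrightarrow> W x = W' x"
  shows "pb_nabla H \<Phi> X W z = pb_nabla H \<Phi>' X W' z"
  using deriv_at_cong[OF assms(1-3)] deriv_at_cong[OF assms(1,2,4)] assms(2-4)
  by (simp add: pb_nabla_def dmap_def)

lemma trace_pb_nabla2_cong:
  assumes "open S" "z \<in> S" "\<And>x. x \<in> S \<Longrightarrow> \<Phi> x = \<Phi>' x" "\<And>x. x \<in> S \<Longrightarrow> W x = W' x"
  shows "trace_pb_nabla2 G H e \<Phi> W z = trace_pb_nabla2 G H e \<Phi>' W' z"
proof -
  have p: "pb_nabla H \<Phi> X W x = pb_nabla H \<Phi>' X W' x" if "x \<in> S" for x X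
    by (rule pb_nabla_cong[OF assms(1) that assms(3,4)])
  have "pb_nabla H \<Phi> X (pb_nabla H \<Phi> X W) z = pb_nabla H \<Phi>' X (pb_nabla H \<Phi>' X W') z" for X
    by (rule pb_nabla_cong[OF assms(1-3) p])
  then show ?thesis by (simp add: trace_pb_nabla2_def p[OF assms(2)])
qed

lemma tension_cong:
  assumes "open S" "z \<in> S" "\<And>x. x \<in> S \<Longrightarrow> \<Phi> x = \<Phi>' x"
  shows "tension G H e \<Phi> z = tension G H e \<Phi>' z"
proof -
  have "dmap \<Phi> X x = dmap \<Phi>' X x" if "x \<in> S" for X x
    using deriv_at_cong[OF assms(1) that assms(3)] by (simp add: dmap_def)
  then show ?thesis unfolding tension_def
    using pb_nabla_cong[OF assms, where W = "dmap \<Phi> _" and W' = "dmap \<Phi>' _"] assms(2) by simp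
qed

text \<open>Coordinate expressions such as \<open>map_coord\<close> have a simple form only on a
  chart range. The bitension differentiates the tension field, so the tension must agree on a
  neighbourhood and not just at \<open>z\<close>.\<close>

lemma f_bitension_cong:
  assumes "open S" "z \<in> S" "\<And>x. x \<in> S \<Longrightarrow> \<Phi> x = \<Phi>' x" "\<And>x. x \<in> S \<Longrightarrow> f x = f' x"
  shows "f_bitension G H e f \<Phi> z = f_bitension G H e f' \<Phi>' z"
proof -
  have d: "dmap \<Phi> X z = dmap \<Phi>' X z" for X
    using deriv_at_cong[OF assms(1-3)] by (simp add: dmap_def)
  have t: "tension G H e \<Phi> x = tension G H e \<Phi>' x" if "x \<in> S" for x
    by (rule tension_cong[OF assms(1) that assms(3)])
  have "trace_pb_nabla2 G H e \<Phi> (\<lambda>x. f x *\<^sub>R tension G H e \<Phi> x) z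
      = trace_pb_nabla2 G H e \<Phi>' (\<lambda>x. f' x *\<^sub>R tension G H e \<Phi>' x) z"
    by (rule trace_pb_nabla2_cong[OF assms(1-3)]) (simp_all add: t assms(4))
  then show ?thesis by (simp add: f_bitension_def d t[OF assms(2)] assms(2-4))
qed

lemma metric_chart_subset: "metric_chart S G \<Longrightarrow> open U \<Longrightarrow> U \<subseteq> S \<Longrightarrow> metric_chart U G"
  unfolding metric_chart_def using smooth_on_subset by blast

section \<open>Tensoriality of second derivatives along a map, and their Leibniz rule\<close>

locale map_chart = source: metric_chart S G + target: metric_chart T H
  for S :: "'a::euclidean_space set" and G and T :: "'b::euclidean_space set" and H +
  fixes \<Phi> :: "'a \<Rightarrow> 'b"
  assumes map_into: "z \<in> S \<Longrightarrow> \<Phi> z \<in> T" and smooth_map: "smooth_on S \<Phi>"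
begin

lemma bilinear_christoffel_map: "z \<in> S \<Longrightarrow> bilinear (christoffel H (\<Phi> z))"
  by (rule target.bilinear_christoffel[OF map_into])

lemma smooth_christoffel_map: "smooth_on S (\<lambda>x. christoffel H (\<Phi> x) u v)"
  by (rule smooth_on_compose[OF source.open_domain target.open_domain _ smooth_map target.smooth_christoffel])
    (auto intro: map_into)

lemma differentiable_christoffel_map: "z \<in> S \<Longrightarrow> (\<lambda>x. christoffel H (\<Phi> x) u v) differentiable at z"
  using smooth_christoffel_map smooth_on_differentiable by blast

lemma differentiable_map: "z \<in> S \<Longrightarrow> \<Phi> differentiable at z"
  using smooth_map smooth_on_differentiable by blast

lemma differentiable_deriv_map: "z \<in> S \<Longrightarrow> (\<lambda>x. deriv_at \<Phi> x v) differentiable at z"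
  using smooth_on_deriv[OF smooth_map] smooth_on_differentiable by blast

lemma linear_christoffel_map_left: "z \<in> S \<Longrightarrow> linear (\<lambda>u. christoffel H (\<Phi> z) (deriv_at \<Phi> z u) v)"
  using linear_compose[OF linear_deriv_at[OF differentiable_map] target.linear_christoffel_left[OF map_into]]
  by (simp add: o_def)

lemma linear_along: "z \<in> S \<Longrightarrow> W differentiable at z \<Longrightarrow> linear (along H \<Phi> W z)"
  unfolding along_def by (intro linear_compose_add linear_deriv_at linear_christoffel_map_left)

lemma smooth_along:
  assumes "smooth_on S W" shows "smooth_on S (\<lambda>x. along H \<Phi> W x v)"
  unfolding along_def
  by (rule smooth_on_add[OF source.open_domain smooth_on_deriv[OF assms]
        smooth_on_bilinear_family[OF source.open_domain bilinear_christoffel_map smooth_christoffel_map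
          smooth_on_deriv[OF smooth_map] assms]])

lemma differentiable_along:
  "smooth_on S W \<Longrightarrow> z \<in> S \<Longrightarrow> (\<lambda>x. along H \<Phi> W x v) differentiable at z"
  using smooth_along smooth_on_differentiable by blast

lemma along_linear_family:
  fixes L :: "'a \<Rightarrow> 'c::euclidean_space \<Rightarrow> 'b"
  assumes "z \<in> S" "\<And>x. x \<in> S \<Longrightarrow> linear (L x)" "\<And>b. (\<lambda>x. L x b) differentiable at z"
    "X differentiable at z"
  shows "along H \<Phi> (\<lambda>x. L x (X x)) z u = along H \<Phi> (\<lambda>x. L x (X z)) z u + L z (deriv_at X z u)"
  by (simp add: along_def deriv_at_linear_family[OF source.open_domain assms])

lemma linear_along_parameter:
  assumes "z \<in> S" "\<And>x. x \<in> S \<Longrightarrow> linear (L x)" "\<And>b. (\<lambda>x. L x b) differentiable at z"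
  shows "linear (\<lambda>b. along H \<Phi> (\<lambda>x. L x b) z u)"
proof -
  have "linear (\<lambda>b. christoffel H (\<Phi> z) (deriv_at \<Phi> z u) (L z b))"
    using linear_compose[OF assms(2)[OF assms(1)] target.linear_christoffel_right[OF map_into[OF assms(1)]]]
    by (simp add: o_def)
  note this linear_deriv_at_parameter[OF source.open_domain assms, of u]
  then show ?thesis
    unfolding along_def by (intro linear_compose_add)
qed

lemma bilinear_second_along:
  assumes "smooth_on S W" "z \<in> S" shows "bilinear (second_along G H \<Phi> W z)"
proof -
  note d = smooth_on_differentiable[OF assms(1)]
  have "linear (\<lambda>v. along H \<Phi> W z (christoffel G z u v))" for u
    using linear_compose[OF source.linear_christoffel_right linear_along[OF assms(2) d]] assms(2)
    by (simp add: o_def)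
  moreover have "linear (\<lambda>u. along H \<Phi> W z (christoffel G z u v))" for v
    using linear_compose[OF source.linear_christoffel_left linear_along[OF assms(2) d]] assms(2)
    by (simp add: o_def)
  ultimately show ?thesis
    unfolding bilinear_def second_along_def
    by (intro conjI allI linear_compose_sub linear_along linear_along_parameter linear_along
        differentiable_along d assms)
qed

text \<open>The derivative of \<open>Y\<close> contributes
  \<open>along H \<Phi> W z (deriv_at Y z (X z))\<close> to both terms on the left and cancels; what
  remains depends on the fields through their values at \<open>z\<close>.\<close>

lemma pb_nabla_pb_nabla:
  assumes "smooth_on S W" "z \<in> S" "Y differentiable at z"
  shows "pb_nabla H \<Phi> X (pb_nabla H \<Phi> Y W) z - pb_nabla H \<Phi> (nabla G X Y) W z
    = second_along G H \<Phi> W z (X z) (Y z)"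
proof -
  note d = smooth_on_differentiable[OF assms(1)]
  have p: "pb_nabla H \<Phi> Y W = (\<lambda>x. along H \<Phi> W x (Y x))" by (simp add: pb_nabla_eq_along fun_eq_iff)
  show ?thesis
    unfolding pb_nabla_eq_along p
    using along_linear_family[OF assms(2) linear_along[OF _ d] differentiable_along[OF assms(1,2)] assms(3), of "X z"]
    by (simp add: nabla_def second_along_def linear_add[OF linear_along[OF assms(2) d[OF assms(2)]]])
qed

lemma trace_pb_nabla2_eq:
  assumes "smooth_on S W" "z \<in> S" "\<And>b. b \<in> Basis \<Longrightarrow> e b differentiable at z"
  shows "trace_pb_nabla2 G H e \<Phi> W z = (\<Sum>b\<in>Basis. second_along G H \<Phi> W z (e b z) (e b z))"
  unfolding trace_pb_nabla2_def
  by (intro sum.cong refl pb_nabla_pb_nabla assms)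

lemma tension_eq:
  assumes "z \<in> S" "\<And>b. b \<in> Basis \<Longrightarrow> e b differentiable at z"
  shows "tension G H e \<Phi> z = (\<Sum>b\<in>Basis. second_fundamental G H \<Phi> z (e b z) (e b z))"
  unfolding tension_def
proof (intro sum.cong refl)
  fix b :: 'a assume b: "b \<in> Basis"
  note l = linear_deriv_at[OF differentiable_map]
  have p: "dmap \<Phi> (e b) = (\<lambda>x. deriv_at \<Phi> x (e b x))" by (simp add: dmap_def fun_eq_iff)
  show "pb_nabla H \<Phi> (e b) (dmap \<Phi> (e b)) z - dmap \<Phi> (nabla G (e b) (e b)) z
    = second_fundamental G H \<Phi> z (e b z) (e b z)"
    unfolding pb_nabla_eq_along p
    using along_linear_family[OF assms(1) l differentiable_deriv_map[OF assms(1)] assms(2)[OF b], of "e b z"]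
    by (simp add: nabla_def dmap_def second_fundamental_def linear_add[OF l[OF assms(1)]])
qed

lemma second_along_scaleR:
  assumes "smooth_on S f" "smooth_on S W" "z \<in> S"
  shows "second_along G H \<Phi> (\<lambda>x. f x *\<^sub>R W x) z u v =
    hessian G f z u v *\<^sub>R W z + deriv_at f z v *\<^sub>R along H \<Phi> W z u
    + deriv_at f z u *\<^sub>R along H \<Phi> W z v + f z *\<^sub>R second_along G H \<Phi> W z u v"
proof -
  note df = smooth_on_differentiable[OF assms(1)] and dW = smooth_on_differentiable[OF assms(2)]
  note ddf = smooth_on_differentiable[OF smooth_on_deriv[OF assms(1)] assms(3)]
  note dA = differentiable_along[OF assms(2,3)]
  note b = bilinear_christoffel_map[OF assms(3)]
  note aS = along_scaleR[where H = H and \<Phi> = \<Phi> and z = z, OF b]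
  have D: "(\<lambda>x. p x *\<^sub>R Q x) differentiable at z"
    if "p differentiable at z" "Q differentiable at z" for p :: "'a \<Rightarrow> real" and Q :: "'a \<Rightarrow> 'b"
    using has_derivative_scaleR[OF has_derivative_deriv_at[OF that(1)] has_derivative_deriv_at[OF that(2)]]
    unfolding differentiable_def by blast
  have "along H \<Phi> (\<lambda>x. along H \<Phi> (\<lambda>x. f x *\<^sub>R W x) x v) z u
      = along H \<Phi> (\<lambda>x. deriv_at f x v *\<^sub>R W x + f x *\<^sub>R along H \<Phi> W x v) z u"
    by (rule along_cong[OF source.open_domain assms(3)])
      (simp add: along_scaleR bilinear_christoffel_map df dW)
  also have "\<dots> = along H \<Phi> (\<lambda>x. deriv_at f x v *\<^sub>R W x) z u + along H \<Phi> (\<lambda>x. f x *\<^sub>R along H \<Phi> W x v) z u"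
    by (simp add: along_def deriv_at_add[OF D[OF ddf dW[OF assms(3)]] D[OF df[OF assms(3)] dA, unfolded along_def]]
        bilinear_radd[OF b])
  finally show ?thesis
    by (simp add: second_along_def hessian_def aS df dW dA ddf assms(3) algebra_simps)
qed

text \<open>On the diagonal the two first-order terms of the Leibniz rule coincide, whence the
  factor 2; by the frame expansion of \<open>grad\<close> they sum to a derivative along the
  gradient.\<close>

lemma trace_second_along_scaleR:
  assumes "smooth_on S f" "smooth_on S W" "z \<in> S" "orthonormal_at (G z) e"
  shows "(\<Sum>b\<in>Basis. second_along G H \<Phi> (\<lambda>x. f x *\<^sub>R W x) z (e b) (e b)) =
    laplacian G f z *\<^sub>R W z + 2 *\<^sub>R along H \<Phi> W z (grad G f z)
    + f z *\<^sub>R (\<Sum>b\<in>Basis. second_along G H \<Phi> W z (e b) (e b))"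
proof -
  have l: "linear (along H \<Phi> W z)"
    by (rule linear_along[OF assms(3) smooth_on_differentiable[OF assms(2,3)]])
  have "along H \<Phi> W z (grad G f z) = (\<Sum>b\<in>Basis. deriv_at f z (e b) *\<^sub>R along H \<Phi> W z (e b))"
    unfolding source.grad_expand[OF assms(3) smooth_on_differentiable[OF assms(1,3)] assms(4)]
    by (simp add: linear_sum[OF l] linear_cmul[OF l])
  then show ?thesis
    unfolding second_along_scaleR[OF assms(1-3)] source.laplacian_eq_trace[OF assms(3,1,4)]
    by (simp add: sum.distrib scaleR_sum_left[symmetric] scaleR_sum_right[symmetric] scaleR_2)
qed

end

section \<open>Curvature\<close>

context metric_chart
begin

lemma map_chart_ident: "map_chart S G S G (\<lambda>x. x)"
  by unfold_locales (auto intro: smooth_on_ident)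

lemma curv_at_eq:
  assumes "z \<in> S"
  shows "curv_at G z u v w =
    deriv_at (\<lambda>x. christoffel G x v w) z u - deriv_at (\<lambda>x. christoffel G x u w) z v
    + christoffel G z u (christoffel G z v w) - christoffel G z v (christoffel G z u w)"
proof -
  have c: "nabla G (\<lambda>_. v) (\<lambda>_. w) = (\<lambda>x. christoffel G x v w)" for v w
    by (simp add: nabla_def fun_eq_iff)
  show ?thesis
    unfolding curv_at_def curvature_def c
    by (simp add: nabla_def bracket_def linear_0[OF linear_christoffel_left[OF assms]])
qed

lemma bilinear_curv_at:
  assumes "z \<in> S" shows "bilinear (curv_at G z u)"
proof -
  note b = bilinear_deriv_at_parameter[OF open_domain assms bilinear_christoffel differentiable_christoffel[OF assms],
      unfolded bilinear_def]
  note l = linear_christoffel_left[OF assms] linear_christoffel_right[OF assms]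
  show ?thesis
    unfolding bilinear_def curv_at_eq[OF assms]
    using b l linear_compose[OF l(1) l(2)] linear_compose[OF l(2) l(2)] linear_compose[OF l(2) l(1)]
      linear_deriv_at[OF differentiable_christoffel[OF assms]]
    by (intro conjI allI linear_compose_sub linear_compose_add) (simp_all add: o_def)
qed

lemma linear_curv_at:
  assumes "z \<in> S" shows "linear (\<lambda>u. curv_at G z u v w)"
proof -
  note b = bilinear_deriv_at_parameter[OF open_domain assms bilinear_christoffel differentiable_christoffel[OF assms],
      unfolded bilinear_def]
  note l = linear_christoffel_left[OF assms] linear_christoffel_right[OF assms]
  show ?thesis
    unfolding curv_at_eq[OF assms]
    using b l linear_compose[OF l(1) l(2)]
      linear_deriv_at[OF differentiable_christoffel[OF assms]]
    by (intro linear_compose_sub linear_compose_add) (simp_all add: o_def)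
qed

end

context map_chart
begin

lemma along_along:
  assumes "smooth_on S W" "z \<in> S"
  shows "along H \<Phi> (\<lambda>x. along H \<Phi> W x v) z u =
    deriv_at (\<lambda>x. deriv_at W x v) z u
    + deriv_at (\<lambda>y. christoffel H y (deriv_at \<Phi> z v) (W z)) (\<Phi> z) (deriv_at \<Phi> z u)
    + christoffel H (\<Phi> z) (deriv_at (\<lambda>x. deriv_at \<Phi> x v) z u) (W z)
    + christoffel H (\<Phi> z) (deriv_at \<Phi> z v) (deriv_at W z u)
    + christoffel H (\<Phi> z) (deriv_at \<Phi> z u) (deriv_at W z v)
    + christoffel H (\<Phi> z) (deriv_at \<Phi> z u) (christoffel H (\<Phi> z) (deriv_at \<Phi> z v) (W z))"
proof -
  note dW = smooth_on_differentiable[OF assms]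
  note ddW = smooth_on_differentiable[OF smooth_on_deriv[OF assms(1)] assms(2)]
  note B = source.open_domain assms(2) bilinear_christoffel_map
    differentiable_christoffel_map[OF assms(2)] differentiable_deriv_map[OF assms(2)] dW
  have "deriv_at (\<lambda>x. christoffel H (\<Phi> x) (deriv_at \<Phi> z v) (W z)) z u
     = deriv_at (\<lambda>y. christoffel H y (deriv_at \<Phi> z v) (W z)) (\<Phi> z) (deriv_at \<Phi> z u)"
    by (rule deriv_at_compose[OF differentiable_map[OF assms(2)]
          target.differentiable_christoffel[OF map_into[OF assms(2)]]])
  then show ?thesis
    using deriv_at_bilinear_family[OF B, of v u] deriv_at_add[OF ddW differentiable_bilinear_family[OF B], of v v u]
    by (simp add: along_def bilinear_radd[OF bilinear_christoffel_map[OF assms(2)]])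
qed

text \<open>In the expansion of \<open>along_along\<close>, the second derivatives of
  \<open>W\<close> and of \<open>\<Phi>\<close> are symmetric in \<open>u\<close> and
  \<open>v\<close>, and the two terms with a first derivative of \<open>W\<close> change places. The
  difference is the coordinate formula of the curvature.\<close>

lemma along_commutator:
  assumes "smooth_on S W" "z \<in> S"
  shows "along H \<Phi> (\<lambda>x. along H \<Phi> W x v) z u - along H \<Phi> (\<lambda>x. along H \<Phi> W x u) z v
    = curv_at H (\<Phi> z) (deriv_at \<Phi> z u) (deriv_at \<Phi> z v) (W z)"
  unfolding along_along[OF assms] target.curv_at_eq[OF map_into[OF assms(2)]]
  by (simp add: deriv_at_symmetric[OF source.open_domain assms(1,2), of v u]
      deriv_at_symmetric[OF source.open_domain smooth_map assms(2), of v u])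

end

section \<open>Invariance under isometries of the target\<close>

locale isometry_chart = map_chart S G T H \<Phi>
  for S :: "'a::euclidean_space set" and G and T :: "'a set" and H and \<Phi> +
  assumes isometric: "z \<in> S \<Longrightarrow> H (\<Phi> z) (deriv_at \<Phi> z u) (deriv_at \<Phi> z v) = G z u v"
begin

lemma surj_deriv: "z \<in> S \<Longrightarrow> surj (deriv_at \<Phi> z)"
proof (rule linear_inj_imp_surj)
  assume z: "z \<in> S"
  show l: "linear (deriv_at \<Phi> z)" by (rule linear_deriv_at[OF differentiable_map[OF z]])
  show "inj (deriv_at \<Phi> z)"
    unfolding linear_injective_0[OF l]
  proof (intro allI impI)
    fix u assume "deriv_at \<Phi> z u = 0"
    then have "G z u u = 0"
      using isometric[OF z, of u u] by (simp add: bilinear_lzero[OF target.bilinear_G[OF map_into[OF z]]])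
    then show "u = 0" using inner_form.pos[OF source.inner_form[OF z], of u] by (cases "u = 0") auto
  qed
qed

text \<open>The transformation law of the Christoffel symbols. The isometry condition is
  differentiated and inserted into the Koszul formula of \<open>G\<close>; since the differential is
  surjective, it is enough to compare inner products with image vectors.\<close>

lemma christoffel_natural:
  assumes z: "z \<in> S"
  shows "christoffel H (\<Phi> z) (deriv_at \<Phi> z u) (deriv_at \<Phi> z v) + deriv_at (\<lambda>x. deriv_at \<Phi> x v) z u
    = deriv_at \<Phi> z (christoffel G z u v)"
proof -
  note T = map_into[OF z]
  interpret B: inner_form "H (\<Phi> z)" by (rule target.inner_form[OF T])
  let ?D = "deriv_at \<Phi> z" and ?D2 = "\<lambda>a b. deriv_at (\<lambda>x. deriv_at \<Phi> x b) z a"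
  have s2: "?D2 a b = ?D2 b a" for a b
    by (rule deriv_at_symmetric[OF source.open_domain smooth_map z])
  have dG: "deriv_at (\<lambda>x. G x a b) z c =
      deriv_at (\<lambda>y. H y (?D a) (?D b)) (\<Phi> z) (?D c) + H (\<Phi> z) (?D2 c a) (?D b) + H (\<Phi> z) (?D a) (?D2 c b)"
    for a b c
  proof -
    have "deriv_at (\<lambda>x. G x a b) z c = deriv_at (\<lambda>x. H (\<Phi> x) (deriv_at \<Phi> x a) (deriv_at \<Phi> x b)) z c"
      by (rule fun_cong[OF deriv_at_cong[OF source.open_domain z]]) (simp add: isometric)
    also have "\<dots> = deriv_at (\<lambda>x. H (\<Phi> x) (?D a) (?D b)) z c + H (\<Phi> z) (?D2 c a) (?D b) + H (\<Phi> z) (?D a) (?D2 c b)"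
      by (rule deriv_at_bilinear_family[OF source.open_domain z target.bilinear_G[OF map_into]
            differentiable_compose_at[OF differentiable_map[OF z] target.differentiable_G[OF T]]
            differentiable_deriv_map[OF z] differentiable_deriv_map[OF z]])
    also have "deriv_at (\<lambda>x. H (\<Phi> x) (?D a) (?D b)) z c = deriv_at (\<lambda>y. H y (?D a) (?D b)) (\<Phi> z) (?D c)"
      by (rule deriv_at_compose[OF differentiable_map[OF z] target.differentiable_G[OF T]])
    finally show ?thesis .
  qed
  have eq: "H (\<Phi> z) (christoffel H (\<Phi> z) (?D u) (?D v) + ?D2 u v) (?D \<xi>) = H (\<Phi> z) (?D (christoffel G z u v)) (?D \<xi>)" for \<xi>
    using source.christoffel_koszul[OF z, of u v \<xi>] target.christoffel_koszul[OF T, of "?D u" "?D v" "?D \<xi>"]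
    unfolding isometric[OF z] dG B.form_simps
    using s2[of u v] s2[of u \<xi>] s2[of v \<xi>] B.sym[of "?D u" "?D2 \<xi> v"] B.sym[of "?D u" "?D2 v \<xi>"]
      B.sym[of "?D v" "?D2 u \<xi>"] B.sym[of "?D v" "?D2 \<xi> u"] by simp
  show ?thesis
  proof (rule B.nondegenerate)
    fix \<eta>
    obtain \<xi> where "\<eta> = ?D \<xi>" using surj_deriv[OF z] by (metis surjD)
    then show "H (\<Phi> z) (christoffel H (\<Phi> z) (?D u) (?D v) + ?D2 u v) \<eta> = H (\<Phi> z) (?D (christoffel G z u v)) \<eta>"
      using eq by simp
  qed
qed

lemma deriv_push:
  assumes "map_chart R K S G \<psi>" "z \<in> R" "W differentiable at z"
  shows "deriv_at (\<lambda>x. deriv_at \<Phi> (\<psi> x) (W x)) z v =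
    deriv_at (\<lambda>y. deriv_at \<Phi> y (W z)) (\<psi> z) (deriv_at \<psi> z v) + deriv_at \<Phi> (\<psi> z) (deriv_at W z v)"
proof -
  interpret psi: map_chart R K S G \<psi> by fact
  have d: "(\<lambda>x. deriv_at \<Phi> (\<psi> x) b) differentiable at z" for b
    by (rule differentiable_compose_at[OF psi.differentiable_map[OF assms(2)]
          differentiable_deriv_map[OF psi.map_into[OF assms(2)]]])
  have "deriv_at (\<lambda>x. deriv_at \<Phi> (\<psi> x) (W x)) z v =
      deriv_at (\<lambda>x. deriv_at \<Phi> (\<psi> x) (W z)) z v + deriv_at \<Phi> (\<psi> z) (deriv_at W z v)"
    by (rule deriv_at_linear_family[OF psi.source.open_domain assms(2) _ d assms(3)])
      (rule linear_deriv_at[OF differentiable_map[OF psi.map_into]])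
  also have "deriv_at (\<lambda>x. deriv_at \<Phi> (\<psi> x) (W z)) z v = deriv_at (\<lambda>y. deriv_at \<Phi> y (W z)) (\<psi> z) (deriv_at \<psi> z v)"
    by (rule deriv_at_compose[OF psi.differentiable_map[OF assms(2)]
          differentiable_deriv_map[OF psi.map_into[OF assms(2)]]])
  finally show ?thesis .
qed

text \<open>The transformation law absorbs the second derivative of \<open>\<Phi>\<close> that the
  product rule produces.\<close>

lemma along_natural:
  assumes "map_chart R K S G \<psi>" "z \<in> R" "W differentiable at z"
  shows "along H (\<lambda>x. \<Phi> (\<psi> x)) (\<lambda>x. deriv_at \<Phi> (\<psi> x) (W x)) z v = deriv_at \<Phi> (\<psi> z) (along G \<psi> W z v)"
proof -
  interpret psi: map_chart R K S G \<psi> by fact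
  note z = psi.map_into[OF assms(2)]
  have "deriv_at (\<lambda>x. \<Phi> (\<psi> x)) z v = deriv_at \<Phi> (\<psi> z) (deriv_at \<psi> z v)"
    by (rule deriv_at_compose[OF psi.differentiable_map[OF assms(2)] differentiable_map[OF z]])
  then show ?thesis
    using christoffel_natural[OF z, of "deriv_at \<psi> z v" "W z"]
    by (simp add: along_def deriv_push[OF assms] linear_add[OF linear_deriv_at[OF differentiable_map[OF z]]] add.commute)
qed

lemma smooth_push:
  assumes "map_chart R K S G \<psi>" "smooth_on R W"
  shows "smooth_on R (\<lambda>x. deriv_at \<Phi> (\<psi> x) (W x))"
proof -
  interpret psi: map_chart R K S G \<psi> by fact
  show ?thesis
    by (rule smooth_on_linear_family[OF psi.source.open_domain linear_deriv_at[OF differentiable_map[OF psi.map_into]]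
          smooth_on_compose[OF psi.source.open_domain source.open_domain _ psi.smooth_map smooth_on_deriv[OF smooth_map]]
          assms(2)]) (auto intro: psi.map_into)
qed

lemma map_chart_compose:
  assumes "map_chart R K S G \<psi>" shows "map_chart R K T H (\<lambda>x. \<Phi> (\<psi> x))"
proof -
  interpret psi: map_chart R K S G \<psi> by fact
  show ?thesis
    by unfold_locales (auto intro: map_into psi.map_into
        smooth_on_compose[OF psi.source.open_domain source.open_domain _ psi.smooth_map smooth_map])
qed

lemma second_along_natural:
  assumes "map_chart R K S G \<psi>" "z \<in> R" "smooth_on R W"
  shows "along H (\<lambda>x. \<Phi> (\<psi> x)) (\<lambda>x. along H (\<lambda>x. \<Phi> (\<psi> x)) (\<lambda>x. deriv_at \<Phi> (\<psi> x) (W x)) x v) z u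
    = deriv_at \<Phi> (\<psi> z) (along G \<psi> (\<lambda>x. along G \<psi> W x v) z u)"
proof -
  interpret psi: map_chart R K S G \<psi> by fact
  have "along H (\<lambda>x. \<Phi> (\<psi> x)) (\<lambda>x. along H (\<lambda>x. \<Phi> (\<psi> x)) (\<lambda>x. deriv_at \<Phi> (\<psi> x) (W x)) x v) z u
    = along H (\<lambda>x. \<Phi> (\<psi> x)) (\<lambda>x. deriv_at \<Phi> (\<psi> x) (along G \<psi> W x v)) z u"
    by (rule along_cong[OF psi.source.open_domain assms(2)])
      (rule along_natural[OF assms(1) _ smooth_on_differentiable[OF assms(3)]])
  also have "\<dots> = deriv_at \<Phi> (\<psi> z) (along G \<psi> (\<lambda>x. along G \<psi> W x v) z u)"
    by (rule along_natural[OF assms(1,2) psi.differentiable_along[OF assms(3,2)]])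
  finally show ?thesis .
qed

text \<open>The transformation law need not be differentiated again: the constant section
  \<open>w\<close> is pushed forward by the differential, curvature is the commutator of second
  derivatives on either side, and those are natural because each covariant derivative is.\<close>

lemma curv_at_natural:
  assumes z: "z \<in> S"
  shows "curv_at H (\<Phi> z) (deriv_at \<Phi> z u) (deriv_at \<Phi> z v) (deriv_at \<Phi> z w) = deriv_at \<Phi> z (curv_at G z u v w)"
proof -
  note id = source.map_chart_ident
  interpret id: map_chart S G S G "\<lambda>x. x" by (rule id)
  show ?thesis
    using along_commutator[OF smooth_push[OF id smooth_on_const[of S w]] z, of v u]
      id.along_commutator[OF smooth_on_const[of S w] z, of v u]
    unfolding second_along_natural[OF id z smooth_on_const]
    by (simp add: linear_diff[OF linear_deriv_at[OF differentiable_map[OF z]], symmetric])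
qed

lemma tension_natural:
  assumes "map_chart R K S G \<psi>" "z \<in> R" "\<And>b. b \<in> Basis \<Longrightarrow> e b differentiable at z"
  shows "tension K H e (\<lambda>x. \<Phi> (\<psi> x)) z = deriv_at \<Phi> (\<psi> z) (tension K G e \<psi> z)"
proof -
  interpret psi: map_chart R K S G \<psi> by fact
  interpret comp: map_chart R K T H "\<lambda>x. \<Phi> (\<psi> x)" by (rule map_chart_compose[OF assms(1)])
  note l = linear_deriv_at[OF differentiable_map[OF psi.map_into[OF assms(2)]]]
  have D: "deriv_at (\<lambda>x. \<Phi> (\<psi> x)) x v = deriv_at \<Phi> (\<psi> x) (deriv_at \<psi> x v)" if "x \<in> R" for x v
    by (rule deriv_at_compose[OF psi.differentiable_map[OF that] differentiable_map[OF psi.map_into[OF that]]])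
  have A: "along H (\<lambda>x. \<Phi> (\<psi> x)) (\<lambda>x. deriv_at (\<lambda>x. \<Phi> (\<psi> x)) x v) z u
      = along H (\<lambda>x. \<Phi> (\<psi> x)) (\<lambda>x. deriv_at \<Phi> (\<psi> x) (deriv_at \<psi> x v)) z u" for u v
    by (rule along_cong[OF psi.source.open_domain assms(2)]) (rule D)
  have "second_fundamental K H (\<lambda>x. \<Phi> (\<psi> x)) z u v = deriv_at \<Phi> (\<psi> z) (second_fundamental K G \<psi> z u v)" for u v
    unfolding second_fundamental_def linear_diff[OF l]
      A along_natural[OF assms(1,2) psi.differentiable_deriv_map[OF assms(2)]] D[OF assms(2)] ..
  then show ?thesis
    by (simp add: comp.tension_eq[OF assms(2,3)] psi.tension_eq[OF assms(2,3)] linear_sum[OF l])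
qed

text \<open>Smoothness of the tension field is assumed because the section differentiated twice is
  \<open>f\<close> times that field; for the projection the field is an explicit multiple of
  \<open>V\<close>.\<close>

lemma f_bitension_natural:
  assumes "map_chart R K S G \<psi>" "z \<in> R" "\<And>b. b \<in> Basis \<Longrightarrow> smooth_on R (e b)"
    "smooth_on R f" "smooth_on R (tension K G e \<psi>)"
  shows "f_bitension K H e f (\<lambda>x. \<Phi> (\<psi> x)) z = deriv_at \<Phi> (\<psi> z) (f_bitension K G e f \<psi> z)"
proof -
  interpret psi: map_chart R K S G \<psi> by fact
  interpret comp: map_chart R K T H "\<lambda>x. \<Phi> (\<psi> x)" by (rule map_chart_compose[OF assms(1)])
  note l = linear_deriv_at[OF differentiable_map[OF psi.map_into]]
  note lz = l[OF assms(2)]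
  note de = smooth_on_differentiable[OF assms(3)]
  let ?W = "\<lambda>x. f x *\<^sub>R tension K G e \<psi> x"
  have sW: "smooth_on R ?W" by (rule smooth_on_scaleR[OF psi.source.open_domain assms(4,5)])
  have t: "tension K H e (\<lambda>x. \<Phi> (\<psi> x)) x = deriv_at \<Phi> (\<psi> x) (tension K G e \<psi> x)" if "x \<in> R" for x
    by (rule tension_natural[OF assms(1) that de[OF _ that]])
  have W: "f x *\<^sub>R tension K H e (\<lambda>x. \<Phi> (\<psi> x)) x = deriv_at \<Phi> (\<psi> x) (?W x)" if "x \<in> R" for x
    by (simp add: t[OF that] linear_cmul[OF l[OF that]])
  have D: "dmap (\<lambda>x. \<Phi> (\<psi> x)) X z = deriv_at \<Phi> (\<psi> z) (dmap \<psi> X z)" for X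
    unfolding dmap_def
    by (rule deriv_at_compose[OF psi.differentiable_map[OF assms(2)] differentiable_map[OF psi.map_into[OF assms(2)]]])
  have c: "trace_pb_nabla2 K H e (\<lambda>x. \<Phi> (\<psi> x)) (\<lambda>x. f x *\<^sub>R tension K H e (\<lambda>x. \<Phi> (\<psi> x)) x) z
      = trace_pb_nabla2 K H e (\<lambda>x. \<Phi> (\<psi> x)) (\<lambda>x. deriv_at \<Phi> (\<psi> x) (?W x)) z"
    by (rule trace_pb_nabla2_cong[OF psi.source.open_domain assms(2) refl W])
  have "second_along K H (\<lambda>x. \<Phi> (\<psi> x)) (\<lambda>x. deriv_at \<Phi> (\<psi> x) (?W x)) z u v
      = deriv_at \<Phi> (\<psi> z) (second_along K G \<psi> ?W z u v)" for u v
    unfolding second_along_def second_along_natural[OF assms(1,2) sW] linear_diff[OF lz]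
      along_natural[OF assms(1,2) smooth_on_differentiable[OF sW assms(2)]] ..
  then have "trace_pb_nabla2 K H e (\<lambda>x. \<Phi> (\<psi> x)) (\<lambda>x. deriv_at \<Phi> (\<psi> x) (?W x)) z
      = deriv_at \<Phi> (\<psi> z) (trace_pb_nabla2 K G e \<psi> ?W z)"
    by (simp only: comp.trace_pb_nabla2_eq[OF smooth_push[OF assms(1) sW] assms(2) de[OF _ assms(2)]]
        psi.trace_pb_nabla2_eq[OF sW assms(2) de[OF _ assms(2)]] linear_sum[OF lz])
  with c show ?thesis
    by (simp add: f_bitension_def t[OF assms(2)] D curv_at_natural[OF psi.map_into[OF assms(2)]]
        linear_sum[OF lz] linear_diff[OF lz] linear_neg[OF lz] linear_cmul[OF lz])
qed

end

section \<open>Warped products in a product chart\<close>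

definition warped_metric :: "'a::euclidean_space metric_coeffs \<Rightarrow> ('a \<Rightarrow> real) \<Rightarrow>
    'b::euclidean_space metric_coeffs \<Rightarrow> ('a \<times> 'b) metric_coeffs" where
  "warped_metric g \<mu> h p a b =
     g (fst p) (fst a) (fst b) + (\<mu> (fst p))\<^sup>2 * h (snd p) (snd a) (snd b)"

lemma deriv_at_fst [simp]:
  fixes p :: "'a::euclidean_space \<times> 'b::euclidean_space"
  shows "deriv_at fst p v = fst v"
  by (simp add: deriv_at_eqI[OF bounded_linear_imp_has_derivative[OF bounded_linear_fst]])

lemma deriv_at_compose_fst:
  fixes W :: "'a::euclidean_space \<Rightarrow> 'c::real_normed_vector" and p :: "'a \<times> 'b::euclidean_space"
  assumes "W differentiable at (fst p)"
  shows "deriv_at (\<lambda>p. W (fst p)) p v = deriv_at W (fst p) (fst v)"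
  using deriv_at_compose[of fst p W v] assms
  by (simp add: bounded_linear_imp_differentiable bounded_linear_fst)

lemma deriv_at_slice:
  fixes F :: "'a::euclidean_space \<times> 'b::euclidean_space \<Rightarrow> 'c::real_normed_vector"
  assumes "F differentiable at (z, w)"
  shows "deriv_at (\<lambda>x. F (x, w)) z \<xi> = deriv_at F (z, w) (\<xi>, 0)"
    and "(\<lambda>x. F (x, w)) differentiable at z"
proof -
  have D: "((\<lambda>x. (x, w)) has_derivative (\<lambda>\<xi>. (\<xi>, 0))) (at z)"
    by (intro has_derivative_Pair has_derivative_ident has_derivative_const)
  have C: "((\<lambda>x. F (x, w)) has_derivative (\<lambda>\<xi>. deriv_at F (z, w) (\<xi>, 0))) (at z)"
    using has_derivative_compose[OF D has_derivative_deriv_at[OF assms]] .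
  show "deriv_at (\<lambda>x. F (x, w)) z \<xi> = deriv_at F (z, w) (\<xi>, 0)"
    by (rule fun_cong[OF deriv_at_eqI[OF C]])
  show "(\<lambda>x. F (x, w)) differentiable at z"
    using C unfolding differentiable_def by blast
qed

lemma sum_Basis_prod:
  fixes f :: "'a::euclidean_space \<times> 'b::euclidean_space \<Rightarrow> 'c::comm_monoid_add"
  shows "(\<Sum>b\<in>Basis. f b) = (\<Sum>b\<in>Basis. f (b, 0)) + (\<Sum>c\<in>Basis. f (0, c))"
proof -
  have "inj_on (\<lambda>u. (u::'a, 0::'b)) Basis" "inj_on (\<lambda>u. (0::'a, u::'b)) Basis"
    by (auto intro: inj_onI)
  then show ?thesis
    unfolding Basis_prod_def by (subst sum.union_disjoint) (auto simp: sum.reindex)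
qed

text \<open>Levi-Civita derivatives are pull-backs along the identity, so the tensoriality results
  for maps apply to the trace on \<open>M\<close> as well.\<close>

lemma trace_nabla2_eq_pb: "trace_nabla2 G e X z = trace_pb_nabla2 G G e (\<lambda>x. x) X z"
proof -
  have "nabla G X Y = pb_nabla G (\<lambda>x. x) X Y" for X Y
    by (simp add: fun_eq_iff nabla_eq_cov pb_nabla_eq_along)
  then show ?thesis by (simp add: trace_nabla2_def trace_pb_nabla2_def)
qed

locale warped_chart = base: metric_chart S g + fibre: metric_chart T h
  for S :: "'a::euclidean_space set" and g and T :: "'b::euclidean_space set" and h +
  fixes \<mu> :: "'a \<Rightarrow> real"
  assumes smooth_warping: "smooth_on S \<mu>" and warping_pos: "z \<in> S \<Longrightarrow> \<mu> z > 0"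
begin

abbreviation "G \<equiv> warped_metric g \<mu> h"

definition V :: "'a \<Rightarrow> 'a" where "V = grad g (\<lambda>x. ln (\<mu> x))"

lemma smooth_V: "smooth_on S V"
  unfolding V_def
  by (rule base.smooth_grad[OF smooth_on_ln[OF base.open_domain smooth_warping warping_pos]])

lemma differentiable_V: "z \<in> S \<Longrightarrow> V differentiable at z"
  using smooth_V smooth_on_differentiable by blast

lemma deriv_warping:
  assumes "z \<in> S" shows "deriv_at \<mu> z \<xi> = \<mu> z * g z (V z) \<xi>"
  using base.grad_inner[OF assms smooth_on_differentiable[OF smooth_on_ln[OF base.open_domain smooth_warping warping_pos] assms]]
    warping_pos[OF assms]
  by (simp add: V_def deriv_at_ln[OF base.open_domain smooth_warping warping_pos assms])

lemma open_product: "open (S \<times> T)"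
  by (rule open_Times[OF base.open_domain fibre.open_domain])

lemma smooth_compose_fst: "smooth_on S W \<Longrightarrow> smooth_on (S \<times> T) (\<lambda>p. W (fst p))"
  by (rule smooth_on_compose[OF open_product base.open_domain _ smooth_on_fst[OF open_product]]) auto

lemma smooth_compose_snd: "smooth_on T W \<Longrightarrow> smooth_on (S \<times> T) (\<lambda>p. W (snd p))"
  by (rule smooth_on_compose[OF open_product fibre.open_domain _ smooth_on_snd[OF open_product]]) auto

lemma metric_chart_warped: "metric_chart (S \<times> T) G"
proof (rule metric_chart.intro)
  show "open (S \<times> T)" by (rule open_product)
  show "smooth_on (S \<times> T) (\<lambda>p. G p a b)" for a b
    unfolding warped_metric_def power2_eq_square
    by (intro smooth_on_add smooth_on_mult open_product)
      (rule smooth_compose_fst smooth_compose_snd base.smooth fibre.smooth smooth_warping)+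
  fix p assume p: "p \<in> S \<times> T"
  then have z: "fst p \<in> S" and w: "snd p \<in> T" by auto
  note b = base.bilinear_G[OF z] fibre.bilinear_G[OF w]
  show "inner_form (G p)"
  proof
    show "bilinear (G p)"
      using b unfolding bilinear_def linear_iff warped_metric_def
      by (simp add: algebra_simps)
    show "G p u v = G p v u" for u v
      by (simp add: warped_metric_def base.sym_G[OF z, of "fst u"] fibre.sym_G[OF w, of "snd u"])
    show "0 < G p u u" if "u \<noteq> 0" for u
    proof -
      have nn: "g (fst p) (fst u) (fst u) \<ge> 0" "h (snd p) (snd u) (snd u) \<ge> 0"
        by (intro inner_form.nonneg base.inner_form fibre.inner_form z w)+
      have "fst u \<noteq> 0 \<or> snd u \<noteq> 0" using that by (auto simp: prod_eq_iff)
      then show ?thesis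
        unfolding warped_metric_def
        using nn inner_form.pos[OF base.inner_form[OF z], of "fst u"]
          inner_form.pos[OF fibre.inner_form[OF w], of "snd u"] warping_pos[OF z]
        by (auto intro: add_pos_nonneg add_nonneg_pos)
    qed
  qed
qed

sublocale total: metric_chart "S \<times> T" G by (rule metric_chart_warped)

sublocale proj: map_chart "S \<times> T" G S g fst
  by unfold_locales (auto intro: smooth_on_fst open_product)

text \<open>Testing the Koszul formula against \<open>(\<xi>, 0)\<close> isolates the horizontal
  component. Since \<open>h\<close> vanishes when one slot is 0, two of the three derivatives reduce
  to those of \<open>g\<close>; the warping enters through the derivative of the squared warping
  function in direction \<open>\<xi>\<close>, which is
  \<open>2 * (\<mu> z)\<^sup>2 * g z (V z) \<xi>\<close>.\<close>

lemma fst_christoffel: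
  assumes "z \<in> S" "w \<in> T"
  shows "fst (christoffel G (z, w) a b) =
    christoffel g z (fst a) (fst b) - ((\<mu> z)\<^sup>2 * h w (snd a) (snd b)) *\<^sub>R V z"
proof (rule inner_form.nondegenerate[OF base.inner_form[OF assms(1)]])
  fix \<xi>
  interpret g: inner_form "g z" by (rule base.inner_form[OF assms(1)])
  have p: "(z, w) \<in> S \<times> T" using assms by simp
  have zero: "h w' c 0 = 0" if "w' \<in> T" for w' c by (rule bilinear_rzero[OF fibre.bilinear_G[OF that]])
  have 1: "deriv_at (\<lambda>p. G p c (\<xi>, 0)) (z, w) d = deriv_at (\<lambda>x. g x (fst c) \<xi>) z (fst d)" for c d
  proof -
    have "deriv_at (\<lambda>p. G p c (\<xi>, 0)) (z, w) d = deriv_at (\<lambda>p. g (fst p) (fst c) \<xi>) (z, w) d"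
      by (rule fun_cong[OF deriv_at_cong[OF open_product p]]) (auto simp: warped_metric_def zero)
    then show ?thesis
      using deriv_at_compose_fst[of "\<lambda>x. g x (fst c) \<xi>" "(z, w)" d] base.differentiable_G[OF assms(1)] by simp
  qed
  have 2: "deriv_at (\<lambda>p. G p a b) (z, w) (\<xi>, 0) = deriv_at (\<lambda>x. g x (fst a) (fst b)) z \<xi>
      + 2 * (\<mu> z)\<^sup>2 * h w (snd a) (snd b) * g z (V z) \<xi>"
  proof -
    let ?c = "h w (snd a) (snd b)"
    have D: "((\<lambda>x. g x (fst a) (fst b) + (\<mu> x)\<^sup>2 * ?c) has_derivative
        (\<lambda>\<xi>. deriv_at (\<lambda>x. g x (fst a) (fst b)) z \<xi> + 2 * \<mu> z * deriv_at \<mu> z \<xi> * ?c)) (at z)"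
      using has_derivative_deriv_at[OF base.differentiable_G[OF assms(1), of "fst a" "fst b"]]
        has_derivative_deriv_at[OF smooth_on_differentiable[OF smooth_warping assms(1)]]
      by (auto intro!: derivative_eq_intros simp: fun_eq_iff)
    have "deriv_at (\<lambda>p. G p a b) (z, w) (\<xi>, 0) = deriv_at (\<lambda>x. g x (fst a) (fst b) + (\<mu> x)\<^sup>2 * ?c) z \<xi>"
      using deriv_at_slice(1)[OF total.differentiable_G[OF p], of a b \<xi>] by (simp add: warped_metric_def)
    also have "\<dots> = deriv_at (\<lambda>x. g x (fst a) (fst b)) z \<xi> + 2 * \<mu> z * deriv_at \<mu> z \<xi> * ?c"
      by (rule fun_cong[OF deriv_at_eqI[OF D]])
    finally show ?thesis by (simp add: deriv_warping[OF assms(1)] power2_eq_square)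
  qed
  have "2 * g z (fst (christoffel G (z, w) a b)) \<xi> = 2 * G (z, w) (christoffel G (z, w) a b) (\<xi>, 0)"
    by (simp add: warped_metric_def zero[OF assms(2)])
  also have "\<dots> = 2 * g z (christoffel g z (fst a) (fst b)) \<xi> - 2 * ((\<mu> z)\<^sup>2 * h w (snd a) (snd b)) * g z (V z) \<xi>"
    unfolding total.christoffel_koszul[OF p] base.christoffel_koszul[OF assms(1)] 1 2 by simp
  finally show "g z (fst (christoffel G (z, w) a b)) \<xi> =
      g z (christoffel g z (fst a) (fst b) - ((\<mu> z)\<^sup>2 * h w (snd a) (snd b)) *\<^sub>R V z) \<xi>"
    by (simp add: g.form_simps)
qed

lemma fst_grad:
  assumes "z \<in> S" "w \<in> T" "f differentiable at (z, w)"
  shows "fst (grad G f (z, w)) = grad g (\<lambda>x. f (x, w)) z"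
proof (rule inner_form.nondegenerate[OF base.inner_form[OF assms(1)]])
  fix \<xi>
  have p: "(z, w) \<in> S \<times> T" using assms by simp
  have "g z (fst (grad G f (z, w))) \<xi> = G (z, w) (grad G f (z, w)) (\<xi>, 0)"
    by (simp add: warped_metric_def bilinear_rzero[OF fibre.bilinear_G[OF assms(2)]])
  then show "g z (fst (grad G f (z, w))) \<xi> = g z (grad g (\<lambda>x. f (x, w)) z) \<xi>"
    by (simp add: total.grad_inner[OF p assms(3)] base.grad_inner[OF assms(1) deriv_at_slice(2)[OF assms(3)]]
        deriv_at_slice(1)[OF assms(3)])
qed

lemma trace_warped:
  fixes A :: "'a \<times> 'b \<Rightarrow> 'a \<times> 'b \<Rightarrow> 'c::real_vector"
  assumes "z \<in> S" "w \<in> T" "bilinear A" "orthonormal_at (G (z, w)) E" "orthonormal_at (g z) e"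
    "orthonormal_at (h w) d"
  shows "(\<Sum>b\<in>Basis. A (E b) (E b)) =
    (\<Sum>b\<in>Basis. A (e b, 0) (e b, 0)) + (1 / (\<mu> z)\<^sup>2) *\<^sub>R (\<Sum>c\<in>Basis. A (0, d c) (0, d c))"
proof -
  have p: "(z, w) \<in> S \<times> T" using assms by simp
  interpret g: inner_form "g z" by (rule base.inner_form[OF assms(1)])
  interpret h: inner_form "h w" by (rule fibre.inner_form[OF assms(2)])
  have \<mu>: "\<mu> z > 0" by (rule warping_pos[OF assms(1)])
  \<comment> \<open>Elements of \<open>Basis\<close> of a product have one component 0, so
    \<open>snd p = 0\<close> singles out the horizontal ones. Dividing the vertical vectors by
    \<open>\<mu> z\<close> normalises them for the warped metric and is the origin of the factor
    \<open>1 / (\<mu> z)\<^sup>2\<close>.\<close>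
  define E' where "E' p = (if snd p = 0 then (e (fst p), 0) else (0, (1 / \<mu> z) *\<^sub>R d (snd p)))" for p :: "'a \<times> 'b"
  have eE: "g z (e b) (e c) = (if b = c then 1 else 0)" if "b \<in> Basis" "c \<in> Basis" for b c
    using assms(5) that by (simp add: orthonormal_at_def)
  have dE: "h w (d b) (d c) = (if b = c then 1 else 0)" if "b \<in> Basis" "c \<in> Basis" for b c
    using assms(6) that by (simp add: orthonormal_at_def)
  have "orthonormal_at (G (z, w)) E'"
    using \<mu>
    by (auto simp: eE dE orthonormal_at_def Basis_prod_def E'_def warped_metric_def g.form_simps h.form_simps
        linear_0[OF g.linear_left] linear_0[OF g.linear_right] linear_0[OF h.linear_left] linear_0[OF h.linear_right]
        power2_eq_square split: if_splits)
  from inner_form.trace_independent[OF total.inner_form[OF p] assms(3,4) this]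
  have "(\<Sum>b\<in>Basis. A (E b) (E b)) = (\<Sum>b\<in>Basis. A (E' b) (E' b))" .
  also have "\<dots> = (\<Sum>b\<in>Basis. A (E' (b, 0)) (E' (b, 0))) + (\<Sum>c\<in>Basis. A (E' (0, c)) (E' (0, c)))"
    by (rule sum_Basis_prod)
  also have "(\<Sum>b\<in>Basis. A (E' (b, 0)) (E' (b, 0))) = (\<Sum>b\<in>Basis. A (e b, 0) (e b, 0))"
    by (simp add: E'_def)
  also have "(\<Sum>c\<in>Basis. A (E' (0, c)) (E' (0, c))) = (1 / (\<mu> z)\<^sup>2) *\<^sub>R (\<Sum>c\<in>Basis. A (0, d c) (0, d c))"
    unfolding scaleR_sum_right
  proof (rule sum.cong[OF refl])
    fix c :: 'b assume "c \<in> Basis"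
    then have "E' (0, c) = (1 / \<mu> z) *\<^sub>R (0, d c)" by (auto simp: E'_def)
    then show "A (E' (0, c)) (E' (0, c)) = (1 / (\<mu> z)\<^sup>2) *\<^sub>R A (0, d c) (0, d c)"
      by (simp add: bilinear_lmul[OF assms(3)] bilinear_rmul[OF assms(3)] power2_eq_square del: scaleR_Pair)
  qed
  finally show ?thesis .
qed

text \<open>Three later traces have this shape: a form in the horizontal parts plus the vertical
  metric times a fixed vector \<open>Q\<close>. On an adapted frame the warping factor cancels and
  each vertical vector contributes one \<open>Q\<close>. The tension has \<open>A\<close> zero and
  \<open>Q\<close> equal to \<open>V z\<close>, the trace Laplacian has as \<open>Q\<close> the
  derivative of \<open>V\<close> along itself, and the curvature term has \<open>Q\<close>
  zero.\<close>

lemma trace_horizontal_plus_vertical: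
  fixes A :: "'a \<Rightarrow> 'a \<Rightarrow> 'c::real_vector"
  assumes "z \<in> S" "w \<in> T" "bilinear A" "orthonormal_at (G (z, w)) E" "orthonormal_at (g z) e"
  shows "(\<Sum>b\<in>Basis. A (fst (E b)) (fst (E b)) + ((\<mu> z)\<^sup>2 * h w (snd (E b)) (snd (E b))) *\<^sub>R Q) =
    (\<Sum>b\<in>Basis. A (e b) (e b)) + real DIM('b) *\<^sub>R Q"
proof -
  interpret h: inner_form "h w" by (rule fibre.inner_form[OF assms(2)])
  obtain d where d: "orthonormal_at (h w) d" using h.orthonormal_exists by blast
  have b: "bilinear (\<lambda>a b. A (fst a) (fst b) + ((\<mu> z)\<^sup>2 * h w (snd a) (snd b)) *\<^sub>R Q)"
    using assms(3) h.bilinear unfolding bilinear_def linear_iff by (simp add: algebra_simps)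
  have "(1 / (\<mu> z)\<^sup>2) *\<^sub>R (\<Sum>c\<in>Basis. ((\<mu> z)\<^sup>2 * h w (d c) (d c)) *\<^sub>R Q) = (\<Sum>c\<in>Basis. h w (d c) (d c)) *\<^sub>R Q"
    using warping_pos[OF assms(1)] by (simp add: scaleR_sum_right scaleR_sum_left)
  also have "(\<Sum>c\<in>Basis. h w (d c) (d c)) = real DIM('b)"
    using d by (simp add: orthonormal_at_def)
  finally show ?thesis
    using trace_warped[OF assms(1,2) b assms(4,5) d]
    by (simp add: linear_0[OF h.linear_left] bilinear_lzero[OF assms(3)])
qed

section \<open>Tension and bitension of the projection in a product chart\<close>

lemma second_fundamental_proj:
  assumes "z \<in> S" "w \<in> T"
  shows "second_fundamental G g fst (z, w) a b = ((\<mu> z)\<^sup>2 * h w (snd a) (snd b)) *\<^sub>R V z"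
  \<comment> \<open>The differential of \<open>fst\<close> is constant, so only Christoffel terms
    occur; those of \<open>g\<close> cancel and the correction from the warping survives.\<close>
  by (simp add: second_fundamental_def along_def fst_christoffel[OF assms])

lemma frame_at:
  assumes "orthonormal_frame G U E" "U \<subseteq> S \<times> T" "p \<in> U"
  shows "orthonormal_at (G p) (\<lambda>b. E b p)" "b \<in> Basis \<Longrightarrow> E b differentiable at p"
  using total.orthonormal_frame_at[OF assms(1,3)] assms(1,3)
  by (auto simp: orthonormal_frame_def intro: smooth_on_differentiable)

lemma tension_proj:
  assumes "orthonormal_frame G U E" "U \<subseteq> S \<times> T" "p \<in> U"
  shows "tension G g E fst p = real DIM('b) *\<^sub>R V (fst p)"
proof -
  obtain z w where p: "p = (z, w)" and z: "z \<in> S" and w: "w \<in> T" using assms(2,3) by auto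
  note fr = frame_at[OF assms, unfolded p]
  obtain e where e: "orthonormal_at (g z) e" using inner_form.orthonormal_exists[OF base.inner_form[OF z]] by blast
  have "bilinear (\<lambda>(_::'a) (_::'a). 0::'a)" by (simp add: bilinear_def linear_iff)
  from trace_horizontal_plus_vertical[OF z w this fr(1) e, of "V z"]
  show ?thesis
    unfolding p by (subst proj.tension_eq) (use z w fr in \<open>simp_all add: second_fundamental_proj\<close>)
qed

lemma along_proj:
  assumes "p \<in> S \<times> T" "W differentiable at (fst p)"
  shows "along g fst (\<lambda>p. W (fst p)) p v = cov g W (fst p) (fst v)"
  by (simp add: along_def deriv_at_compose_fst[OF assms(2)])

text \<open>The vertical term comes from the subtracted derivative in the direction of the
  Christoffel vector, whose horizontal part contains a negative multiple of
  \<open>V z\<close>.\<close>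

lemma second_along_proj:
  assumes "z \<in> S" "w \<in> T"
  shows "second_along G g fst (\<lambda>p. V (fst p)) (z, w) a b =
    second_along g g (\<lambda>x. x) V z (fst a) (fst b) + ((\<mu> z)\<^sup>2 * h w (snd a) (snd b)) *\<^sub>R cov g V z (V z)"
proof -
  interpret id: map_chart S g S g "\<lambda>x. x" by (rule base.map_chart_ident)
  have p: "(z, w) \<in> S \<times> T" using assms by simp
  note l = base.linear_cov[OF assms(1) differentiable_V[OF assms(1)]]
  have "along g fst (\<lambda>p. along g fst (\<lambda>p. V (fst p)) p b) (z, w) a
      = along g fst (\<lambda>p. cov g V (fst p) (fst b)) (z, w) a"
    by (rule along_cong[OF open_product p], rule along_proj[OF _ differentiable_V]) auto
  also have "\<dots> = cov g (\<lambda>x. cov g V x (fst b)) z (fst a)"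
    using along_proj[OF p, of "\<lambda>x. cov g V x (fst b)"] id.differentiable_along[OF smooth_V assms(1)] by simp
  finally show ?thesis
    using along_proj[OF p, of V] differentiable_V[OF assms(1)]
    by (simp add: second_along_def fst_christoffel[OF assms] linear_diff[OF l] linear_cmul[OF l])
qed

lemma trace_second_along_proj:
  assumes "z \<in> S" "w \<in> T" "orthonormal_at (G (z, w)) E" "orthonormal_frame g U e" "z \<in> U"
  shows "(\<Sum>b\<in>Basis. second_along G g fst (\<lambda>p. V (fst p)) (z, w) (E b) (E b)) =
    trace_nabla2 g e V z + real DIM('b) *\<^sub>R cov g V z (V z)"
proof -
  interpret id: map_chart S g S g "\<lambda>x. x" by (rule base.map_chart_ident)
  have "e b differentiable at z" if "b \<in> Basis" for b
    using assms(4,5) that by (auto simp: orthonormal_frame_def intro: smooth_on_differentiable)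
  then show ?thesis
    unfolding second_along_proj[OF assms(1,2)]
    using trace_horizontal_plus_vertical[OF assms(1,2) id.bilinear_second_along[OF smooth_V assms(1)] assms(3)
        base.orthonormal_frame_at[OF assms(4,5)]]
    by (simp add: trace_nabla2_eq_pb id.trace_pb_nabla2_eq[OF smooth_V assms(1)])
qed

lemma trace_curv_at_proj:
  assumes "z \<in> S" "w \<in> T" "orthonormal_at (G (z, w)) E" "orthonormal_frame g U e" "z \<in> U"
  shows "(\<Sum>b\<in>Basis. curv_at g z (c *\<^sub>R V z) (fst (E b)) (fst (E b))) = c *\<^sub>R ricci g e V z"
  using trace_horizontal_plus_vertical[OF assms(1,2) base.bilinear_curv_at[OF assms(1)] assms(3)
      base.orthonormal_frame_at[OF assms(4,5)], of "c *\<^sub>R V z" 0]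
  by (simp add: ricci_def linear_cmul[OF base.linear_curv_at[OF assms(1)]] scaleR_sum_right)

text \<open>The factor \<open>n\<close> of the tension comes out of the whole expression; a second
  \<open>n\<close>, from the vertical directions, stays inside and becomes \<open>n/2\<close>
  through \<open>grad_norm_grad\<close>. The frames \<open>E\<close> and \<open>e\<close> are
  unrelated, so independence of the frame is contained in the identity.\<close>

lemma f_bitension_proj:
  assumes f: "smooth_on (S \<times> T) f"
    and E: "orthonormal_frame G U E" "U \<subseteq> S \<times> T" "(z, w) \<in> U"
    and e: "orthonormal_frame g U' e" "z \<in> U'"
  shows "f_bitension G g E f fst (z, w) = - (real DIM('b) *\<^sub>R
    (f (z, w) *\<^sub>R trace_nabla2 g e V z
     + (real DIM('b) / 2 * f (z, w)) *\<^sub>R grad g (\<lambda>x. g x (V x) (V x)) z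
     + f (z, w) *\<^sub>R ricci g e V z
     + laplacian G f (z, w) *\<^sub>R V z
     + 2 *\<^sub>R nabla g (grad g (\<lambda>x. f (x, w))) V z))"
proof -
  let ?n = "real DIM('b)"
  have p: "(z, w) \<in> S \<times> T" and z: "z \<in> S" and w: "w \<in> T" using E(2,3) by auto
  have U: "open U" using E(1) by (simp add: orthonormal_frame_def)
  note fr = frame_at[OF E]
  have sV: "smooth_on (S \<times> T) (\<lambda>p. V (fst p))" by (rule smooth_compose_fst[OF smooth_V])
  note sfV = smooth_on_scaleR[OF open_product f sV]
  note scale = smooth_on_scaleR[OF open_product smooth_on_const sfV, of ?n]
  have "trace_pb_nabla2 G g E fst (\<lambda>p. f p *\<^sub>R tension G g E fst p) (z, w)
      = trace_pb_nabla2 G g E fst (\<lambda>p. ?n *\<^sub>R (f p *\<^sub>R V (fst p))) (z, w)"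
    by (rule trace_pb_nabla2_cong[OF U E(3) refl]) (simp add: tension_proj[OF E(1,2)] mult.commute)
  also have "\<dots> = (\<Sum>b\<in>Basis. second_along G g fst (\<lambda>p. ?n *\<^sub>R (f p *\<^sub>R V (fst p))) (z, w) (E b (z, w)) (E b (z, w)))"
    by (rule proj.trace_pb_nabla2_eq[OF scale p fr(2)])
  \<comment> \<open>The constant \<open>?n\<close> is treated as a smooth function whose derivative
    and Hessian in the Leibniz rule vanish.\<close>
  also have "\<dots> = ?n *\<^sub>R (\<Sum>b\<in>Basis. second_along G g fst (\<lambda>p. f p *\<^sub>R V (fst p)) (z, w) (E b (z, w)) (E b (z, w)))"
    unfolding proj.second_along_scaleR[OF smooth_on_const sfV p] by (simp add: hessian_def scaleR_sum_right)
  also have "\<dots> = ?n *\<^sub>R (laplacian G f (z, w) *\<^sub>R V z + 2 *\<^sub>R nabla g (grad g (\<lambda>x. f (x, w))) V z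
      + f (z, w) *\<^sub>R (trace_nabla2 g e V z + ?n *\<^sub>R cov g V z (V z)))"
    unfolding proj.trace_second_along_scaleR[OF f sV p fr(1)] trace_second_along_proj[OF z w fr(1) e]
    using along_proj[OF p, of V] differentiable_V[OF z] fst_grad[OF z w smooth_on_differentiable[OF f p]]
    by (simp add: nabla_eq_cov)
  finally have 1: "trace_pb_nabla2 G g E fst (\<lambda>p. f p *\<^sub>R tension G g E fst p) (z, w) = \<dots>" .
  have 2: "(\<Sum>b\<in>Basis. curv_at g (fst (z, w)) (tension G g E fst (z, w)) (dmap fst (E b) (z, w)) (dmap fst (E b) (z, w)))
      = ?n *\<^sub>R ricci g e V z"
    using trace_curv_at_proj[OF z w fr(1) e, of ?n] by (simp add: tension_proj[OF E] dmap_def)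
  have 3: "grad g (\<lambda>x. g x (V x) (V x)) z = 2 *\<^sub>R cov g V z (V z)"
    unfolding V_def
    by (rule base.grad_norm_grad[OF z smooth_on_ln[OF base.open_domain smooth_warping warping_pos]])
  show ?thesis unfolding f_bitension_def 1 2 3 by (simp add: algebra_simps)
qed

end

section \<open>Manifolds and their charts\<close>

context
  fixes M :: "('i, 'p::{t2_space,second_countable_topology}, 'a::euclidean_space) riem"
  assumes M: "riemannian_manifold M"
begin

lemma charts_cover: "\<exists>i. x \<in> cdom M i"
  using M unfolding riemannian_manifold_def smooth_atlas_def by blast

lemma open_cdom: "open (cdom M i)" and open_crange: "open (crange M i)"
  and homeomorphism_chart: "homeomorphism (cdom M i) (crange M i) (coord M i) (cinv M i)"
  and smooth_transition: "smooth_on (coord M i ` (cdom M i \<inter> cdom M j)) (transition M i j)"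
  using M unfolding riemannian_manifold_def smooth_atlas_def by blast+

lemma cinv_coord: "x \<in> cdom M i \<Longrightarrow> cinv M i (coord M i x) = x"
  and coord_cinv: "z \<in> crange M i \<Longrightarrow> coord M i (cinv M i z) = z"
  and coord_in_crange: "x \<in> cdom M i \<Longrightarrow> coord M i x \<in> crange M i"
  and cinv_in_cdom: "z \<in> crange M i \<Longrightarrow> cinv M i z \<in> cdom M i"
  using homeomorphism_chart[of i] unfolding homeomorphism_def by auto

lemma metric_chart: "metric_chart (crange M i) (gcoeffs M i)"
  using M unfolding riemannian_manifold_def riemannian_metric_def
  by (intro metric_chart.intro inner_form.intro open_crange) blast+

lemma open_overlap: "open (coord M i ` (cdom M i \<inter> cdom M j))"
proof -
  have "openin (top_of_set (crange M i)) (coord M i ` (cdom M i \<inter> cdom M j))"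
    by (rule homeomorphism_imp_open_map[OF homeomorphism_chart]) (simp add: openin_open_Int open_cdom)
  then show ?thesis by (simp add: openin_open_eq open_crange)
qed

lemma isometry_transition:
  "isometry_chart (coord M i ` (cdom M i \<inter> cdom M j)) (gcoeffs M i) (crange M j) (gcoeffs M j) (transition M i j)"
proof -
  let ?O = "coord M i ` (cdom M i \<inter> cdom M j)"
  have sub: "?O \<subseteq> crange M i" using coord_in_crange by auto
  have into: "transition M i j z \<in> crange M j" if "z \<in> ?O" for z
    using that coord_in_crange by (auto simp: transition_def cinv_coord)
  show ?thesis
  proof (intro isometry_chart.intro map_chart.intro map_chart_axioms.intro isometry_chart_axioms.intro)
    show "metric_chart ?O (gcoeffs M i)"
      by (rule metric_chart_subset[OF metric_chart open_overlap sub])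
    show "gcoeffs M j (transition M i j z) (deriv_at (transition M i j) z u) (deriv_at (transition M i j) z v)
      = gcoeffs M i z u v" if "z \<in> ?O" for z u v
      using M that unfolding riemannian_manifold_def riemannian_metric_def by blast
  qed (auto intro: metric_chart smooth_transition into)
qed

text \<open>A vanishing derivative makes \<open>f\<close> constant on coordinate balls, which are
  convex; hence each level set and its complement are open, and connectedness leaves a single level
  set.\<close>

lemma constant_if_deriv_zero:
  assumes f: "smooth_fun M f" and 0: "\<And>i z \<xi>. z \<in> crange M i \<Longrightarrow> deriv_at (f \<circ> cinv M i) z \<xi> = 0"
  shows "f constant_on UNIV"
proof -
  have nbhd: "\<exists>A. open A \<and> x \<in> A \<and> (\<forall>y\<in>A. f y = f x)" for x
  proof -
    obtain i where i: "x \<in> cdom M i" using charts_cover by blast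
    obtain r where r: "r > 0" "ball (coord M i x) r \<subseteq> crange M i"
      using open_crange coord_in_crange[OF i] open_contains_ball by blast
    have D: "((f \<circ> cinv M i) has_derivative (\<lambda>_. 0)) (at z within ball (coord M i x) r)"
      if "z \<in> ball (coord M i x) r" for z
    proof -
      have z: "z \<in> crange M i" using r(2) that by blast
      have "(f \<circ> cinv M i) differentiable at z"
        using f z smooth_on_differentiable unfolding smooth_fun_def by blast
      moreover have "frechet_derivative (f \<circ> cinv M i) (at z) = (\<lambda>_. 0)" using 0[OF z] by (simp add: fun_eq_iff)
      ultimately show ?thesis by (metis has_derivative_deriv_at has_derivative_at_withinI)
    qed
    obtain c where c: "(f \<circ> cinv M i) z = c" if "z \<in> ball (coord M i x) r" for z
      using has_derivative_zero_constant[OF convex_ball D] by blast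
    let ?A = "cdom M i \<inter> coord M i -` ball (coord M i x) r"
    have "open ?A"
      using homeomorphism_chart[of i] unfolding homeomorphism_def
      by (intro continuous_open_preimage open_cdom) auto
    moreover have "f y = c" if "y \<in> ?A" for y
      using c[of "coord M i y"] that by (simp add: cinv_coord)
    moreover have "x \<in> ?A" using i r(1) by simp
    ultimately show ?thesis by metis
  qed
  have "open {y. f y = f x}" for x
    unfolding open_subopen[of "{y. f y = f x}"] using nbhd by (simp add: subset_iff) metis
  moreover have "open {y. f y \<noteq> f x}" for x
    unfolding open_subopen[of "{y. f y \<noteq> f x}"] using nbhd by (simp add: subset_iff) metis
  then have "closed {y. f y = f x}" for x by (simp add: closed_def Collect_neg_eq[symmetric])
  moreover have "connected (UNIV :: 'p set)" using M by (simp add: riemannian_manifold_def)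
  ultimately have "{y. f y = f x} = UNIV" for x
    unfolding connected_clopen by (metis (mono_tags, lifting) empty_iff mem_Collect_eq open_openin closed_closedin subtopology_UNIV)
  then show ?thesis unfolding constant_on_def by auto
qed

end

section \<open>The projection of the global warped product\<close>

locale warped_manifolds =
  fixes M :: "('i, 'p::{t2_space,second_countable_topology}, 'a::euclidean_space) riem"
    and N :: "('j, 'q::{t2_space,second_countable_topology}, 'b::euclidean_space) riem"
    and lam :: "'p \<Rightarrow> real"
  assumes M: "riemannian_manifold M" and N: "riemannian_manifold N"
    and smooth_lam: "smooth_fun M lam" and lam_pos: "lam x > 0"
begin

abbreviation "P \<equiv> warped_product M lam N"

abbreviation "\<mu> i \<equiv> (\<lambda>z. lam (cinv M i z))"

lemma warped_chart: "warped_chart (crange M i) (gcoeffs M i) (crange N j) (gcoeffs N j) (\<mu> i)"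
  using smooth_lam lam_pos
  by (intro warped_chart.intro warped_chart_axioms.intro metric_chart M N)
    (simp_all add: smooth_fun_def o_def)

sublocale chart: warped_chart "crange M i" "gcoeffs M i" "crange N j" "gcoeffs N j" "\<mu> i" for i j
  by (rule warped_chart)

lemma cdom_P: "cdom P (i, j) = cdom M i \<times> cdom N j"
  by (simp add: warped_product_def)

lemma coord_P: "coord P (i, j) (x, y) = (coord M i x, coord N j y)"
  by (simp add: warped_product_def)

lemma gcoeffs_P: "gcoeffs P (i, j) = warped_metric (gcoeffs M i) (\<mu> i) (gcoeffs N j)"
  by (simp add: warped_product_def warped_metric_def fun_eq_iff)

lemma crange_P: "crange P (i, j) = crange M i \<times> crange N j"
  unfolding crange_def cdom_P by (auto simp: coord_P image_iff)

lemma cinv_P: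
  assumes "z \<in> crange M i" "w \<in> crange N j"
  shows "cinv P (i, j) (z, w) = (cinv M i z, cinv N j w)"
proof -
  have "inj_on (coord P (i, j)) (cdom P (i, j))"
  proof (rule inj_onI)
    fix p q assume "p \<in> cdom P (i, j)" "q \<in> cdom P (i, j)" "coord P (i, j) p = coord P (i, j) q"
    then show "p = q"
      by (cases p; cases q) (simp add: cdom_P coord_P, metis cinv_coord[OF M] cinv_coord[OF N])
  qed
  moreover have "(cinv M i z, cinv N j w) \<in> cdom P (i, j)"
    by (simp add: cdom_P cinv_in_cdom[OF M] cinv_in_cdom[OF N] assms)
  moreover have "coord P (i, j) (cinv M i z, cinv N j w) = (z, w)"
    by (simp add: coord_P coord_cinv[OF M] coord_cinv[OF N] assms)
  ultimately show ?thesis unfolding cinv_def[of P] by (metis inv_into_f_f)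
qed

lemma map_coord_fst:
  assumes "p \<in> crange M i \<times> crange N j"
  shows "map_coord P M fst (i, j) k p = transition M i k (fst p)"
  using assms by (auto simp: map_coord_def transition_def cinv_P)

lemma map_coord_fst_same:
  assumes "p \<in> crange M i \<times> crange N j"
  shows "map_coord P M fst (i, j) i p = fst p"
  using assms by (auto simp: map_coord_def cinv_P coord_cinv[OF M])

lemma overlap_P:
  "coord P (i, j) ` (cdom P (i, j) \<inter> fst -` cdom M k) = (coord M i ` (cdom M i \<inter> cdom M k)) \<times> crange N j"
  unfolding cdom_P crange_def by (force simp: coord_P image_iff)

lemma smooth_map_fst: "smooth_map P M fst"
  unfolding smooth_map_def
proof (intro conjI allI)
  show "continuous_on UNIV (fst :: 'p \<times> 'q \<Rightarrow> 'p)" by (intro continuous_intros)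
  fix ij :: "'i \<times> 'j" and k :: 'i
  obtain i j where ij: "ij = (i, j)" by (cases ij)
  let ?O = "coord M i ` (cdom M i \<inter> cdom M k)"
  have o: "open (?O \<times> crange N j)" by (intro open_Times open_overlap open_crange M N)
  have sub: "?O \<subseteq> crange M i" using coord_in_crange[OF M] by auto
  have "smooth_on (?O \<times> crange N j) (map_coord P M fst (i, j) k)"
  proof (rule smooth_on_cong[OF o])
    show "smooth_on (?O \<times> crange N j) (\<lambda>p. transition M i k (fst p))"
      by (rule smooth_on_compose[OF o open_overlap[OF M] _ smooth_on_fst[OF o] smooth_transition[OF M]]) auto
    show "transition M i k (fst p) = map_coord P M fst (i, j) k p" if "p \<in> ?O \<times> crange N j" for p
      using that sub by (intro map_coord_fst[symmetric]) auto
  qed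
  then show "smooth_on (coord P ij ` (cdom P ij \<inter> fst -` cdom M k)) (map_coord P M fst ij k)"
    by (simp add: ij overlap_P)
qed

text \<open>The left-hand side of the equation in the chart \<open>i\<close>, written as in the
  theorem so that unfolding it finishes the proof. The chart \<open>j\<close> of \<open>N\<close>
  enters through the Laplacian of the warped product.\<close>

definition bitension_factor :: "('p \<times> 'q \<Rightarrow> real) \<Rightarrow> 'i \<Rightarrow> 'j \<Rightarrow> ('a \<Rightarrow> 'a \<Rightarrow> 'a) \<Rightarrow> 'p \<Rightarrow> 'q \<Rightarrow> 'a" where
  "bitension_factor f i j e x y = (let g = gcoeffs M i;
            z = coord M i x;
            V = grad g (\<lambda>z'. ln (lam (cinv M i z')))
        in f (x, y) *\<^sub>R trace_nabla2 g e V z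
           + (real DIM('b) / 2 * f (x, y)) *\<^sub>R grad g (\<lambda>z'. g z' (V z') (V z')) z
           + f (x, y) *\<^sub>R ricci g e V z
           + laplacian (gcoeffs P (i, j)) (f \<circ> cinv P (i, j)) (z, coord N j y) *\<^sub>R V z
           + 2 *\<^sub>R nabla g (grad g (\<lambda>z'. f (cinv M i z', y))) V z)"

lemma f_bitension_fst:
  assumes f: "smooth_fun P f" and x: "x \<in> cdom M i" and y: "y \<in> cdom N j"
    and E: "orthonormal_frame (gcoeffs P (i, j)) U E" "U \<subseteq> crange P (i, j)" "coord P (i, j) (x, y) \<in> U"
    and e: "orthonormal_frame (gcoeffs M i) U' e" "coord M i x \<in> U'"
  shows "f_bitension (gcoeffs P (i, j)) (gcoeffs M i) E (f \<circ> cinv P (i, j)) fst (coord P (i, j) (x, y))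
    = - (real DIM('b) *\<^sub>R bitension_factor f i j e x y)"
proof -
  let ?F = "f \<circ> cinv P (i, j)" and ?z = "coord M i x" and ?w = "coord N j y"
  have z: "?z \<in> crange M i" and w: "?w \<in> crange N j"
    using x y coord_in_crange[OF M] coord_in_crange[OF N] by auto
  have F: "smooth_on (crange M i \<times> crange N j) ?F" using f by (simp add: smooth_fun_def flip: crange_P)
  have Fzw: "?F (?z, ?w) = f (x, y)" by (simp add: cinv_P z w cinv_coord[OF M x] cinv_coord[OF N y])
  \<comment> \<open>The partial gradient in the equation freezes the point \<open>y\<close>, the one
    in the chart freezes its coordinates; the two readings of \<open>f\<close> agree on the open
    chart range, hence so do their derivatives at \<open>?z\<close>.\<close>
  have G: "grad (gcoeffs M i) (\<lambda>z'. f (cinv P (i, j) (z', ?w))) ?z = grad (gcoeffs M i) (\<lambda>z'. f (cinv M i z', y)) ?z"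
    unfolding grad_def
    by (subst deriv_at_cong[OF open_crange[OF M] z, where g = "\<lambda>z'. f (cinv M i z', y)"])
      (simp_all add: cinv_P w cinv_coord[OF N y])
  show ?thesis
    using chart.f_bitension_proj[OF F E(1)[unfolded gcoeffs_P] E(2)[unfolded crange_P] E(3)[unfolded coord_P] e]
    unfolding coord_P gcoeffs_P bitension_factor_def Let_def Fzw
    by (simp add: chart.V_def[abs_def] nabla_eq_cov G)
qed

lemma frame_on_chart_exists: "\<exists>E. orthonormal_frame (gcoeffs P (i, j)) (crange P (i, j)) E"
  using chart.total.frame_exists by (simp add: gcoeffs_P crange_P)

text \<open>The tension is \<open>n\<close> times the gradient of the logarithm of
  \<open>lam\<close>; if it vanished in all charts, so would the derivative of \<open>lam\<close>,
  and connectedness would make \<open>lam\<close> constant.\<close>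

lemma not_harmonic_fst:
  assumes "\<not> lam constant_on UNIV" shows "\<not> harmonic P M fst"
proof
  assume harm: "harmonic P M fst"
  have "deriv_at (lam \<circ> cinv M i) z \<xi> = 0" if z: "z \<in> crange M i" for i z \<xi>
  proof -
    obtain y j where y: "y \<in> cdom N j" using charts_cover[OF N] by blast
    let ?x = "cinv M i z" and ?w = "coord N j y"
    have w: "?w \<in> crange N j" by (rule coord_in_crange[OF N y])
    have x: "?x \<in> cdom M i" by (rule cinv_in_cdom[OF M z])
    have c: "coord P (i, j) (?x, y) = (z, ?w)" by (simp add: coord_P coord_cinv[OF M z])
    have p: "(z, ?w) \<in> crange P (i, j)" using z w by (simp add: crange_P)
    obtain E where E: "orthonormal_frame (gcoeffs P (i, j)) (crange P (i, j)) E"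
      using frame_on_chart_exists by blast
    have "tension (gcoeffs P (i, j)) (gcoeffs M i) E (map_coord P M fst (i, j) i) (z, ?w) = 0"
    proof -
      have "(?x, y) \<in> cdom P (i, j) \<and> fst (?x, y) \<in> cdom M i \<and> coord P (i, j) (?x, y) \<in> crange P (i, j)"
        using x y p c by (simp add: cdom_P)
      then show ?thesis using harm E unfolding harmonic_def c[symmetric] by blast
    qed
    moreover have "tension (gcoeffs P (i, j)) (gcoeffs M i) E (map_coord P M fst (i, j) i) (z, ?w)
        = tension (gcoeffs P (i, j)) (gcoeffs M i) E fst (z, ?w)"
      by (rule tension_cong[OF chart.open_product]) (use z w in \<open>auto simp: map_coord_fst_same\<close>)
    moreover have "\<dots> = real DIM('b) *\<^sub>R chart.V i z"
      using chart.tension_proj[OF E[unfolded gcoeffs_P crange_P] _ p[unfolded crange_P]]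
      by (simp add: gcoeffs_P)
    ultimately have "chart.V i z = 0" by simp
    then show ?thesis
      using chart.deriv_warping[OF z, of \<xi>] bilinear_lzero[OF chart.base.bilinear_G[OF z]]
      by (simp add: o_def)
  qed
  then show False using constant_if_deriv_zero[OF M smooth_lam] assms by blast
qed

text \<open>In the chart \<open>k\<close> the projection is \<open>fst\<close> followed by a
  transition map, so its bitension is the image under a linear map of the one in the chart
  \<open>i\<close>, and a linear map sends 0 to 0.\<close>

lemma f_bitension_fst_other_chart:
  assumes f: "smooth_fun P f" and x: "x \<in> cdom M i" "x \<in> cdom M k" and y: "y \<in> cdom N j"
    and E: "orthonormal_frame (gcoeffs P (i, j)) U E" "U \<subseteq> crange P (i, j)" "coord P (i, j) (x, y) \<in> U"
    and fst0: "f_bitension (gcoeffs P (i, j)) (gcoeffs M i) E (f \<circ> cinv P (i, j)) fst (coord P (i, j) (x, y)) = 0"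
  shows "f_bitension (gcoeffs P (i, j)) (gcoeffs M k) E (f \<circ> cinv P (i, j))
      (map_coord P M fst (i, j) k) (coord P (i, j) (x, y)) = 0"
proof -
  let ?O = "coord M i ` (cdom M i \<inter> cdom M k)" and ?p = "coord P (i, j) (x, y)"
  let ?R = "U \<inter> (?O \<times> crange N j)"
  interpret T: isometry_chart ?O "gcoeffs M i" "crange M k" "gcoeffs M k" "transition M i k"
    by (rule isometry_transition[OF M])
  have U: "open U" and sE: "\<And>b. b \<in> Basis \<Longrightarrow> smooth_on U (E b)"
    using E(1) by (auto simp: orthonormal_frame_def)
  have R: "open ?R" by (intro open_Int U open_Times T.source.open_domain open_crange[OF N])
  have sub: "?R \<subseteq> crange M i \<times> crange N j" using E(2) by (auto simp: crange_P)
  have p: "?p \<in> ?R" using E(3) x coord_in_crange[OF N y] by (auto simp: coord_P)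
  have chart: "map_chart ?R (gcoeffs P (i, j)) ?O (gcoeffs M i) fst"
    by (intro map_chart.intro map_chart_axioms.intro smooth_on_fst R T.source.metric_chart_axioms
        metric_chart_subset[OF chart.metric_chart_warped R sub, folded gcoeffs_P]) auto
  have V: "smooth_on ?R (tension (gcoeffs P (i, j)) (gcoeffs M i) E fst)"
  proof (rule smooth_on_cong[OF R])
    show "smooth_on ?R (\<lambda>p. real DIM('b) *\<^sub>R chart.V i (fst p))"
      by (intro smooth_on_scaleR R smooth_on_const
          smooth_on_subset[OF chart.smooth_compose_fst[OF chart.smooth_V] sub])
    show "real DIM('b) *\<^sub>R chart.V i (fst p) = tension (gcoeffs P (i, j)) (gcoeffs M i) E fst p" if "p \<in> ?R" for p
      using chart.tension_proj[OF E(1)[unfolded gcoeffs_P] E(2)[unfolded crange_P]] that by (simp add: gcoeffs_P)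
  qed
  have F: "smooth_on ?R (f \<circ> cinv P (i, j))"
    using f sub by (auto simp: smooth_fun_def crange_P[symmetric] intro: smooth_on_subset)
  have "f_bitension (gcoeffs P (i, j)) (gcoeffs M k) E (f \<circ> cinv P (i, j)) (map_coord P M fst (i, j) k) ?p
      = f_bitension (gcoeffs P (i, j)) (gcoeffs M k) E (f \<circ> cinv P (i, j)) (\<lambda>p. transition M i k (fst p)) ?p"
    by (rule f_bitension_cong[OF R p]) (use sub in \<open>auto intro!: map_coord_fst\<close>)
  also have "\<dots> = deriv_at (transition M i k) (fst ?p) 0"
    unfolding fst0[symmetric]
    by (rule T.f_bitension_natural[OF chart p smooth_on_subset[OF sE] F V]) auto
  also have "\<dots> = 0"
    using p by (intro linear_0 linear_deriv_at T.differentiable_map) auto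
  finally show ?thesis .
qed

text \<open>From left to right, a frame on the product chart is chosen and the target is read in the
  same chart \<open>i\<close>, where the projection is \<open>fst\<close>; from right to left, a
  frame on the chart of \<open>M\<close> is chosen and an arbitrary target chart is reached by
  naturality. In either case the given frame may be arbitrary because \<open>f_bitension_fst\<close>
  relates unrelated frames.\<close>

lemma f_biharmonic_fst_iff:
  assumes f: "smooth_fun P f" and pos: "\<forall>p. f p > 0"
  shows "f_biharmonic P M f fst \<longleftrightarrow>
    (\<forall>i j x y U e. x \<in> cdom M i \<and> y \<in> cdom N j \<and>
       coord M i x \<in> U \<and> U \<subseteq> crange M i \<and> orthonormal_frame (gcoeffs M i) U e \<longrightarrow>
       bitension_factor f i j e x y = 0)"
proof (intro iffI allI impI; (elim conjE)?)
  fix i j x y U e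
  assume biharm: "f_biharmonic P M f fst" and x: "x \<in> cdom M i" and y: "y \<in> cdom N j"
    and U: "coord M i x \<in> U" "U \<subseteq> crange M i" and e: "orthonormal_frame (gcoeffs M i) U e"
  let ?p = "coord P (i, j) (x, y)"
  have p: "?p \<in> crange P (i, j)"
    using coord_in_crange[OF M x] coord_in_crange[OF N y] by (simp add: crange_P coord_P)
  obtain E where E: "orthonormal_frame (gcoeffs P (i, j)) (crange P (i, j)) E"
    using frame_on_chart_exists by blast
  have "f_bitension (gcoeffs P (i, j)) (gcoeffs M i) E (f \<circ> cinv P (i, j)) (map_coord P M fst (i, j) i) ?p = 0"
  proof -
    have "(x, y) \<in> cdom P (i, j) \<and> fst (x, y) \<in> cdom M i" using x y by (simp add: cdom_P)
    then show ?thesis using biharm E p unfolding f_biharmonic_def by blast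
  qed
  moreover have "f_bitension (gcoeffs P (i, j)) (gcoeffs M i) E (f \<circ> cinv P (i, j)) (map_coord P M fst (i, j) i) ?p
      = f_bitension (gcoeffs P (i, j)) (gcoeffs M i) E (f \<circ> cinv P (i, j)) fst ?p"
    by (rule f_bitension_cong[OF chart.open_product p[unfolded crange_P]]) (simp_all add: map_coord_fst_same)
  ultimately show "bitension_factor f i j e x y = 0"
    using f_bitension_fst[OF f x y E order.refl p e U(1)] by simp
next
  assume eq: "\<forall>i j x y U e. x \<in> cdom M i \<and> y \<in> cdom N j \<and>
       coord M i x \<in> U \<and> U \<subseteq> crange M i \<and> orthonormal_frame (gcoeffs M i) U e \<longrightarrow>
       bitension_factor f i j e x y = 0"
  have "f_bitension (gcoeffs P ij) (gcoeffs M k) E (f \<circ> cinv P ij) (map_coord P M fst ij k) (coord P ij p) = 0"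
    if p: "p \<in> cdom P ij" "fst p \<in> cdom M k" and U: "coord P ij p \<in> U" "U \<subseteq> crange P ij"
      and E: "orthonormal_frame (gcoeffs P ij) U E" for ij k p U E
  proof -
    obtain i j where ij: "ij = (i, j)" by (cases ij)
    obtain x y where xy: "p = (x, y)" by (cases p)
    have x: "x \<in> cdom M i" "x \<in> cdom M k" and y: "y \<in> cdom N j" using p by (auto simp: ij xy cdom_P)
    obtain e where e: "orthonormal_frame (gcoeffs M i) (crange M i) e"
      using orthonormal_frame_exists_chart[OF M] by blast
    note z = coord_in_crange[OF M x(1)]
    have "bitension_factor f i j e x y = 0" using eq x(1) y z e by blast
    then have "f_bitension (gcoeffs P (i, j)) (gcoeffs M i) E (f \<circ> cinv P (i, j)) fst (coord P (i, j) (x, y)) = 0"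
      using f_bitension_fst[OF f x(1) y E[unfolded ij] U(2)[unfolded ij] U(1)[unfolded ij xy] e z] by simp
    then show ?thesis
      unfolding ij xy
      by (rule f_bitension_fst_other_chart[OF f x y E[unfolded ij] U(2)[unfolded ij] U(1)[unfolded ij xy]])
  qed
  then show "f_biharmonic P M f fst"
    unfolding f_biharmonic_def using f pos smooth_map_fst by blast
qed

end

theorem proposition6p6:
  fixes M :: "('i, 'p::{t2_space,second_countable_topology}, 'a::euclidean_space) riem"
    and N :: "('j, 'q::{t2_space,second_countable_topology}, 'b::euclidean_space) riem"
    and lam :: "'p \<Rightarrow> real"
    and f :: "'p \<times> 'q \<Rightarrow> real"
  assumes "riemannian_manifold M" and "riemannian_manifold N"
    and "smooth_fun M lam" and "\<forall>x. lam x > 0" and "\<not> lam constant_on UNIV"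
    and "smooth_fun (warped_product M lam N) f" and "\<forall>p. f p > 0" and "\<not> f constant_on UNIV"
  shows "nontrivial_f_biharmonic (warped_product M lam N) M f fst \<longleftrightarrow>
    (\<forall>i j x y U e. x \<in> cdom M i \<and> y \<in> cdom N j \<and>
       coord M i x \<in> U \<and> U \<subseteq> crange M i \<and> orthonormal_frame (gcoeffs M i) U e \<longrightarrow>
       (let g = gcoeffs M i;
            z = coord M i x;
            V = grad g (\<lambda>z'. ln (lam (cinv M i z')))
        in f (x, y) *\<^sub>R trace_nabla2 g e V z
           + (real DIM('b) / 2 * f (x, y)) *\<^sub>R grad g (\<lambda>z'. g z' (V z') (V z')) z
           + f (x, y) *\<^sub>R ricci g e V z
           + laplacian (gcoeffs (warped_product M lam N) (i, j))
               (f \<circ> cinv (warped_product M lam N) (i, j)) (z, coord N j y) *\<^sub>R V z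
           + 2 *\<^sub>R nabla g (grad g (\<lambda>z'. f (cinv M i z', y))) V z
           = 0))"
proof -
  interpret warped_manifolds M N lam
    using assms by unfold_locales auto
  \<comment> \<open>Beyond the Euler--Lagrange equation, non-constancy of \<open>f\<close> is
    assumed and non-harmonicity follows from non-constancy of \<open>lam\<close>.\<close>
  have "nontrivial_f_biharmonic P M f fst \<longleftrightarrow> f_biharmonic P M f fst"
    using not_harmonic_fst[OF assms(5)] assms(8) by (simp add: nontrivial_f_biharmonic_def)
  then show ?thesis
    unfolding f_biharmonic_fst_iff[OF assms(6,7)] bitension_factor_def Let_def .
qed

end
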